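(* Let $\kappa>0$ and $\tau\neq0$ (so that $E(\kappa,\tau)$ is a Berger sphere, the round case $\kappa=4\tau^2$ being included). Then there exist a smooth, compact, oriented torus $\Sigma$ immersed in $E(\kappa,\tau)$, whose mean curvature $H$ is not constant, and a finite constant $h_0\ge0$ such that $$|dH|_g\le h_0\,|\mathcal Q_{\mathrm{AR}}|_g\quad\text{on }\Sigma,$$ where $g$ is the induced metric and $\mathcal Q_{\mathrm{AR}}$ the Abresch--Rosenberg differential of $\Sigma$. In particular, for $\tau\ne0$, an inequality $|dH|_g\le h\,|\mathcal Q_{\mathrm{AR}}|_g$ with $h$ a continuous nonnegative function does not imply that $H$ is constant on every complete immersed surface.
   Context: Ambient space. For $\kappa,\tau\in\mathbb R$ with $\tau\ne0$, $E(\kappa,\tau)$ is the (unique up to isometry) simply connected oriented homogeneous Riemannian 3-manifold admitting a Riemannian submersion $\pi:E(\kappa,\tau)\to M^2(\kappa)$ onto the simply connected complete surface of constant curvature $\kappa$, with geodesic fibers and unit vertical Killing field $\xi$ satisfying $\overline\nabla_X\xi=\tau\,X\times\xi$, where $\overline\nabla$ is the Levi-Civita connection and $\times$ the cross product determined by metric and orientation. The constant-curvature case $\kappa=4\tau^2$ (round sphere $S^3$ of curvature $\tau^2$) is included. The Berger spheres are the spaces $E(\kappa,\tau)$ with $\kappa>0$, $\tau\neq0$. Put $k=\kappa-4\tau^2$. Surface. For a smooth immersion $\psi$ of an oriented surface $\Sigma$, $g$ is the induced metric, $N$ the unit normal such that $JX=N\times X$ is the positive rotation by $\pi/2$ in the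 tangent planes of $\Sigma$, $S=-\overline\nabla N$ the shape operator, and $H=\frac12\operatorname{tr}S$ the mean curvature. Abresch--Rosenberg differential. In a local conformal parameter $\zeta$ (compatible with the orientation), write $g=\lambda|d\zeta|^2$, $p=\langle S\partial_\zeta,\partial_\zeta\rangle$, $A=\langle\xi,\partial_\zeta\rangle$ (with $S$ and $\langle\cdot,\cdot\rangle$ extended $\mathbb C$-bilinearly). Then $\mathcal Q_{\mathrm{AR}}=Q_{\mathrm{AR}}\,d\zeta^2$ with $$Q_{\mathrm{AR}}=2(H+i\tau)p-kA^2 .$$ Norms. $|\mathcal Q_{\mathrm{AR}}|_g=|Q_{\mathrm{AR}}|/\lambda$, and $|dH|_g$ is the norm of $dH$ with respect to $g$, i.e. $|dH|_g^2=\lambda^{-1}(H_x^2+H_y^2)$ for $\zeta=x+iy$. *)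

theory Defs
  imports "HOL-Analysis.Analysis"
begin

section \<open>The spaces $E(\kappa,\tau)$ with $\kappa > 0$, $\tau \neq 0$\<close>

text \<open>
  The model is the unit sphere of \<open>\<complex>\<^sup>2\<close> with the Berger metric.  Tangent vectors at \<open>p\<close> are the
  vectors \<open>X\<close> of \<open>\<complex>\<^sup>2\<close> with \<open>X \<bullet> p = 0\<close> (real inner product).  The lemmas of this section show
  that the model has the properties that characterise \<open>E(\<kappa>,\<tau>)\<close>.
\<close>

type_synonym C2 = "complex \<times> complex"

abbreviation S3 :: "C2 set" where
  "S3 \<equiv> sphere 0 1"

definition times_i :: "C2 \<Rightarrow> C2" where
  "times_i p = (\<i> * fst p, \<i> * snd p)"

definition berger_metric :: "real \<Rightarrow> real \<Rightarrow> C2 \<Rightarrow> C2 \<Rightarrow> C2 \<Rightarrow> real" where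
  "berger_metric \<kappa> \<tau> p X Y =
     4 / \<kappa> * (X \<bullet> Y + (4 * \<tau>\<^sup>2 / \<kappa> - 1) * (X \<bullet> times_i p) * (Y \<bullet> times_i p))"

definition berger_xi :: "real \<Rightarrow> real \<Rightarrow> C2 \<Rightarrow> C2" where
  "berger_xi \<kappa> \<tau> p = (\<kappa> / (4 * \<tau>)) *\<^sub>R times_i p"

definition berger_e1 :: "real \<Rightarrow> C2 \<Rightarrow> C2" where
  "berger_e1 \<kappa> p = (sqrt \<kappa> / 2) *\<^sub>R (- cnj (snd p), cnj (fst p))"

definition berger_e2 :: "real \<Rightarrow> C2 \<Rightarrow> C2" where
  "berger_e2 \<kappa> p = - times_i (berger_e1 \<kappa> p)"

text \<open>
  The orientation is the one for which the orthonormal frame (\<open>berger_e1\<close>, \<open>berger_e2\<close>, \<open>berger_xi\<close>)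
  is positive.
\<close>

definition berger_cross :: "real \<Rightarrow> real \<Rightarrow> C2 \<Rightarrow> C2 \<Rightarrow> C2 \<Rightarrow> C2" where
  "berger_cross \<kappa> \<tau> p X Y =
     (let G = berger_metric \<kappa> \<tau> p; e1 = berger_e1 \<kappa> p; e2 = berger_e2 \<kappa> p; e3 = berger_xi \<kappa> \<tau> p in
        (G X e2 * G Y e3 - G X e3 * G Y e2) *\<^sub>R e1
      + (G X e3 * G Y e1 - G X e1 * G Y e3) *\<^sub>R e2
      + (G X e1 * G Y e2 - G X e2 * G Y e1) *\<^sub>R e3)"

text \<open>
  A connection on the sphere is encoded by the difference \<open>\<Gamma>\<close> to the flat derivative \<open>D\<close> of
  \<open>\<complex>\<^sup>2\<close>: \<open>\<nabla>\<^sub>X Y = D\<^sub>X Y + \<Gamma> p X Y\<close>.  As \<open>[X, Y] = D\<^sub>X Y - D\<^sub>Y X\<close>, torsion freeness is symmetry of \<open>\<Gamma>\<close>.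
\<close>

definition levi_civita :: "real \<Rightarrow> real \<Rightarrow> (C2 \<Rightarrow> C2 \<Rightarrow> C2 \<Rightarrow> C2) \<Rightarrow> bool" where
  "levi_civita \<kappa> \<tau> \<Gamma> \<longleftrightarrow>
     (\<forall>p\<in>S3. \<forall>X Y. X \<bullet> p = 0 \<and> Y \<bullet> p = 0 \<longrightarrow> \<Gamma> p X Y = \<Gamma> p Y X) \<and>
     (\<forall>c Y Z c' Y' Z' t.
        (\<forall>s. c s \<in> S3 \<and> Y s \<bullet> c s = 0 \<and> Z s \<bullet> c s = 0) \<and>
        (c has_vector_derivative c') (at t) \<and>
        (Y has_vector_derivative Y') (at t) \<and>
        (Z has_vector_derivative Z') (at t) \<longrightarrow>
        (Y' + \<Gamma> (c t) c' (Y t)) \<bullet> c t = 0 \<and>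
        ((\<lambda>s. berger_metric \<kappa> \<tau> (c s) (Y s) (Z s)) has_real_derivative
           berger_metric \<kappa> \<tau> (c t) (Y' + \<Gamma> (c t) c' (Y t)) (Z t) +
           berger_metric \<kappa> \<tau> (c t) (Y t) (Z' + \<Gamma> (c t) c' (Z t))) (at t))"

definition berger_phi :: "C2 \<Rightarrow> C2 \<Rightarrow> C2" where
  "berger_phi p X = times_i X + (X \<bullet> times_i p) *\<^sub>R p"

definition berger_Gamma :: "real \<Rightarrow> real \<Rightarrow> C2 \<Rightarrow> C2 \<Rightarrow> C2 \<Rightarrow> C2" where
  "berger_Gamma \<kappa> \<tau> p X Y = (X \<bullet> Y) *\<^sub>R p + (4 * \<tau>\<^sup>2 / \<kappa> - 1) *\<^sub>R
     ((Y \<bullet> times_i p) *\<^sub>R berger_phi p X + (X \<bullet> times_i p) *\<^sub>R berger_phi p Y)"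

text \<open>Covariant derivative at \<open>z\<close>, in direction \<open>v\<close>, of a vector field \<open>Y\<close> along a map \<open>r\<close>.\<close>

definition berger_nabla ::
    "real \<Rightarrow> real \<Rightarrow> ('a::real_normed_vector \<Rightarrow> C2) \<Rightarrow> ('a \<Rightarrow> C2) \<Rightarrow> 'a \<Rightarrow> 'a \<Rightarrow> C2" where
  "berger_nabla \<kappa> \<tau> r Y z v = frechet_derivative Y (at z) v
     + berger_Gamma \<kappa> \<tau> (r z) (frechet_derivative r (at z) v) (Y z)"

lemma times_i_inner [simp]: "times_i X \<bullet> times_i Y = X \<bullet> Y"
  by (simp add: times_i_def inner_prod_def inner_complex_def)

lemma times_i_skew: "times_i X \<bullet> Y = - (X \<bullet> times_i Y)"
  by (simp add: times_i_def inner_prod_def inner_complex_def)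

lemma times_i_self [simp]: "X \<bullet> times_i X = 0" "times_i X \<bullet> X = 0"
  by (simp_all add: times_i_def inner_prod_def inner_complex_def)

lemma times_i_twice [simp]: "times_i (times_i X) = - X"
  by (simp add: times_i_def prod_eq_iff)

lemma times_i_linear: "bounded_linear times_i"
proof -
  have "linear times_i"
    by (rule linearI) (simp_all add: times_i_def algebra_simps prod_eq_iff)
  then show ?thesis by (rule linear_conv_bounded_linear[THEN iffD1])
qed

lemmas times_i_add = bounded_linear.linear[OF times_i_linear, THEN linear_add]
lemmas times_i_scaleR = bounded_linear.linear[OF times_i_linear, THEN linear_scale]

lemma S3_inner: "p \<in> S3 \<Longrightarrow> p \<bullet> p = 1"
  by (simp add: norm_eq_1)

lemma berger_frame:
  assumes "\<kappa> > 0" "\<tau> \<noteq> 0" "p \<in> S3"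
  shows "berger_e1 \<kappa> p \<bullet> p = 0" "berger_e2 \<kappa> p \<bullet> p = 0" "berger_xi \<kappa> \<tau> p \<bullet> p = 0"
    and "berger_metric \<kappa> \<tau> p (berger_e1 \<kappa> p) (berger_e1 \<kappa> p) = 1"
    and "berger_metric \<kappa> \<tau> p (berger_e2 \<kappa> p) (berger_e2 \<kappa> p) = 1"
    and "berger_metric \<kappa> \<tau> p (berger_xi \<kappa> \<tau> p) (berger_xi \<kappa> \<tau> p) = 1"
    and "berger_metric \<kappa> \<tau> p (berger_e1 \<kappa> p) (berger_e2 \<kappa> p) = 0"
    and "berger_metric \<kappa> \<tau> p (berger_e1 \<kappa> p) (berger_xi \<kappa> \<tau> p) = 0"
    and "berger_metric \<kappa> \<tau> p (berger_e2 \<kappa> p) (berger_xi \<kappa> \<tau> p) = 0"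
proof -
  define e where "e = (- cnj (snd p), cnj (fst p))"
  have pp: "p \<bullet> p = 1" using assms by (simp add: S3_inner)
  have e: "e \<bullet> e = 1" "e \<bullet> p = 0" "e \<bullet> times_i p = 0"
    using pp by (simp_all add: e_def times_i_def inner_prod_def inner_complex_def)
  have e1: "berger_e1 \<kappa> p = (sqrt \<kappa> / 2) *\<^sub>R e" by (simp add: berger_e1_def e_def)
  have e2: "berger_e2 \<kappa> p = - ((sqrt \<kappa> / 2) *\<^sub>R times_i e)"
    by (simp add: berger_e2_def e1 times_i_scaleR)
  have e': "times_i e \<bullet> p = 0" using e(3) by (simp add: times_i_skew)
  have s: "sqrt \<kappa> * sqrt \<kappa> = \<kappa>" using assms by simp
  show "berger_e1 \<kappa> p \<bullet> p = 0" "berger_e2 \<kappa> p \<bullet> p = 0" "berger_xi \<kappa> \<tau> p \<bullet> p = 0"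
    by (simp_all add: e1 e2 e e' berger_xi_def)
  show "berger_metric \<kappa> \<tau> p (berger_e1 \<kappa> p) (berger_e1 \<kappa> p) = 1"
    "berger_metric \<kappa> \<tau> p (berger_e2 \<kappa> p) (berger_e2 \<kappa> p) = 1"
    "berger_metric \<kappa> \<tau> p (berger_e1 \<kappa> p) (berger_e2 \<kappa> p) = 0"
    "berger_metric \<kappa> \<tau> p (berger_e1 \<kappa> p) (berger_xi \<kappa> \<tau> p) = 0"
    "berger_metric \<kappa> \<tau> p (berger_e2 \<kappa> p) (berger_xi \<kappa> \<tau> p) = 0"
    using assms s
    by (simp_all add: berger_metric_def e1 e2 e e' berger_xi_def field_simps)
  show "berger_metric \<kappa> \<tau> p (berger_xi \<kappa> \<tau> p) (berger_xi \<kappa> \<tau> p) = 1"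
    using assms pp by (simp add: berger_metric_def berger_xi_def field_simps power2_eq_square)
qed

lemma berger_phi_frame:
  assumes "p \<in> S3" "X \<bullet> p = 0"
  shows "berger_phi p X = (X \<bullet> (- cnj (snd p), cnj (fst p))) *\<^sub>R times_i (- cnj (snd p), cnj (fst p))
    - (X \<bullet> times_i (- cnj (snd p), cnj (fst p))) *\<^sub>R (- cnj (snd p), cnj (fst p))"
proof -
  have "(p \<bullet> p) *\<^sub>R times_i X = (X \<bullet> p) *\<^sub>R times_i p - (X \<bullet> times_i p) *\<^sub>R p
    + (X \<bullet> (- cnj (snd p), cnj (fst p))) *\<^sub>R times_i (- cnj (snd p), cnj (fst p))
    - (X \<bullet> times_i (- cnj (snd p), cnj (fst p))) *\<^sub>R (- cnj (snd p), cnj (fst p))"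
    by (simp add: times_i_def inner_prod_def inner_complex_def prod_eq_iff complex_eq_iff algebra_simps)
  then show ?thesis using assms by (simp add: berger_phi_def S3_inner)
qed

text \<open>In particular \<open>\<nabla>\<^sub>\<xi> \<xi> = 0\<close> and \<open>\<nabla>\<xi>\<close> is skew, i.e. the fibres are geodesics and \<open>\<xi>\<close> is Killing.\<close>

lemma berger_nabla_xi:
  assumes "\<kappa> > 0" "\<tau> \<noteq> 0" "p \<in> S3" "X \<bullet> p = 0"
  shows "berger_nabla \<kappa> \<tau> (\<lambda>x. x) (berger_xi \<kappa> \<tau>) p X
    = \<tau> *\<^sub>R berger_cross \<kappa> \<tau> p X (berger_xi \<kappa> \<tau> p)"
proof -
  define e where "e = (- cnj (snd p), cnj (fst p))"
  have pp: "p \<bullet> p = 1" using assms by (simp add: S3_inner)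
  have ep: "e \<bullet> times_i p = 0" "e \<bullet> p = 0"
    by (simp_all add: e_def times_i_def inner_prod_def inner_complex_def)
  have e1: "berger_e1 \<kappa> p = (sqrt \<kappa> / 2) *\<^sub>R e" by (simp add: berger_e1_def e_def)
  have e2: "berger_e2 \<kappa> p = - ((sqrt \<kappa> / 2) *\<^sub>R times_i e)"
    by (simp add: berger_e2_def e1 times_i_scaleR)
  have s: "sqrt \<kappa> * sqrt \<kappa> = \<kappa>" using assms by simp
  have s': "sqrt \<kappa> * (sqrt \<kappa> * x) = \<kappa> * x" for x
    using s by (metis mult.assoc)
  have g: "berger_metric \<kappa> \<tau> p X (berger_e1 \<kappa> p) = 2 * sqrt \<kappa> / \<kappa> * (X \<bullet> e)"
    "berger_metric \<kappa> \<tau> p X (berger_e2 \<kappa> p) = - 2 * sqrt \<kappa> / \<kappa> * (X \<bullet> times_i e)"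
    by (simp_all add: berger_metric_def e1 e2 ep)
  have sym: "berger_metric \<kappa> \<tau> p (berger_xi \<kappa> \<tau> p) (berger_e1 \<kappa> p) = 0"
    "berger_metric \<kappa> \<tau> p (berger_xi \<kappa> \<tau> p) (berger_e2 \<kappa> p) = 0"
    using berger_frame(8,9)[OF assms(1-3)] by (simp_all add: berger_metric_def inner_commute mult_ac)
  have "berger_cross \<kappa> \<tau> p X (berger_xi \<kappa> \<tau> p) = (X \<bullet> e) *\<^sub>R times_i e - (X \<bullet> times_i e) *\<^sub>R e"
    using assms(1) by (simp add: berger_cross_def Let_def berger_frame(6)[OF assms(1-3)] sym g)
      (simp add: e1 e2 field_simps s')
  also have "\<dots> = berger_phi p X"
    using berger_phi_frame[OF assms(3,4)] by (simp add: e_def)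
  finally have cross: "berger_cross \<kappa> \<tau> p X (berger_xi \<kappa> \<tau> p) = berger_phi p X" .
  have "bounded_linear (berger_xi \<kappa> \<tau>)"
    unfolding berger_xi_def[abs_def]
    by (rule bounded_linear_compose[OF bounded_linear_scaleR_right times_i_linear])
  then have D: "frechet_derivative (berger_xi \<kappa> \<tau>) (at p) = berger_xi \<kappa> \<tau>"
    by (metis bounded_linear_imp_has_derivative frechet_derivative_at)
  have D': "frechet_derivative (\<lambda>x. x) (at p) = (\<lambda>x. x)" by (rule frechet_derivative_ident)
  have "berger_phi p (berger_xi \<kappa> \<tau> p) = 0"
    using pp by (simp add: berger_phi_def berger_xi_def times_i_scaleR)
  then have "berger_nabla \<kappa> \<tau> (\<lambda>x. x) (berger_xi \<kappa> \<tau>) p X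
      = (\<kappa> / (4 * \<tau>)) *\<^sub>R times_i X + (\<kappa> / (4 * \<tau>) * (X \<bullet> times_i p)) *\<^sub>R p
        + ((4 * \<tau>\<^sup>2 / \<kappa> - 1) * (\<kappa> / (4 * \<tau>))) *\<^sub>R berger_phi p X"
    using pp by (simp add: berger_nabla_def D D' berger_Gamma_def berger_xi_def)
  also have "\<dots> = (\<kappa> / (4 * \<tau>) + (4 * \<tau>\<^sup>2 / \<kappa> - 1) * (\<kappa> / (4 * \<tau>))) *\<^sub>R berger_phi p X"
    by (simp add: berger_phi_def algebra_simps)
  also have "\<kappa> / (4 * \<tau>) + (4 * \<tau>\<^sup>2 / \<kappa> - 1) * (\<kappa> / (4 * \<tau>)) = \<tau>"
    using assms by (simp add: field_simps power2_eq_square)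
  finally show ?thesis by (simp add: cross)
qed

lemma levi_civita_berger_Gamma: "levi_civita \<kappa> \<tau> (berger_Gamma \<kappa> \<tau>)"
  unfolding levi_civita_def
proof (intro conjI ballI allI impI)
  fix p X Y :: C2
  show "berger_Gamma \<kappa> \<tau> p X Y = berger_Gamma \<kappa> \<tau> p Y X"
    by (simp add: berger_Gamma_def inner_commute add_ac)
next
  fix c Y Z :: "real \<Rightarrow> C2" and c' Y' Z' t
  assume A: "(\<forall>s. c s \<in> S3 \<and> Y s \<bullet> c s = 0 \<and> Z s \<bullet> c s = 0) \<and>
        (c has_vector_derivative c') (at t) \<and>
        (Y has_vector_derivative Y') (at t) \<and>
        (Z has_vector_derivative Z') (at t)"
  then have tan: "\<And>s. c s \<bullet> c s = 1" "\<And>s. Y s \<bullet> c s = 0" "\<And>s. Z s \<bullet> c s = 0"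
    by (auto simp: S3_inner)
  have dc: "(c has_vector_derivative c') (at t)" and dY: "(Y has_vector_derivative Y') (at t)"
    and dZ: "(Z has_vector_derivative Z') (at t)" using A by auto
  have ip: "((\<lambda>s. f s \<bullet> g s) has_real_derivative (f t \<bullet> g' + f' \<bullet> g t)) (at t)"
    if "(f has_vector_derivative f') (at t)" "(g has_vector_derivative g') (at t)"
    for f g :: "real \<Rightarrow> C2" and f' g'
    using bounded_bilinear.has_vector_derivative[OF bounded_bilinear_inner that]
    by (simp add: has_real_derivative_iff_has_vector_derivative)
  have const: "x = 0" if "((\<lambda>s. k) has_real_derivative x) (at t)" for x k :: real
    using that DERIV_const DERIV_unique by blast
  have cc: "c' \<bullet> c t = 0"
    using const[of 1 "c t \<bullet> c' + c' \<bullet> c t"] ip[OF dc dc] tan by (simp add: inner_commute)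
  have YX: "Y' \<bullet> c t = - (c' \<bullet> Y t)"
    using const[of 0] ip[OF dY dc] tan by (force simp: inner_commute)
  have dI: "((\<lambda>s. times_i (c s)) has_vector_derivative times_i c') (at t)"
    by (rule bounded_linear.has_vector_derivative[OF times_i_linear dc])
  have phi: "berger_phi (c t) X \<bullet> c t = 0" "c t \<bullet> berger_phi (c t) X = 0" for X
    using tan by (simp_all add: berger_phi_def inner_simps times_i_skew inner_commute)
  show "(Y' + berger_Gamma \<kappa> \<tau> (c t) c' (Y t)) \<bullet> c t = 0"
    using tan by (simp add: berger_Gamma_def inner_simps phi YX)
  have phiI: "berger_phi (c t) X \<bullet> times_i (c t) = 0" if "X \<bullet> c t = 0" for X
    using that by (simp add: berger_phi_def inner_simps)
  have phiW: "berger_phi (c t) X \<bullet> W = times_i X \<bullet> W" if "W \<bullet> c t = 0" for X W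
    using that by (simp add: berger_phi_def inner_simps inner_commute)
  have G1: "berger_metric \<kappa> \<tau> (c t) (U + berger_Gamma \<kappa> \<tau> (c t) c' V) W
      = 4 / \<kappa> * (U \<bullet> W + (4 * \<tau>\<^sup>2 / \<kappa> - 1) * ((V \<bullet> times_i (c t)) * (times_i c' \<bullet> W)
         + (c' \<bullet> times_i (c t)) * (times_i V \<bullet> W) + (U \<bullet> times_i (c t)) * (W \<bullet> times_i (c t))))"
    if "V \<bullet> c t = 0" "W \<bullet> c t = 0" for U V W
    using that phiI[of V] phiI[OF cc] phiW[of W]
    by (simp add: berger_metric_def berger_Gamma_def inner_simps inner_commute[of "c t"]) argo
  have sym: "berger_metric \<kappa> \<tau> (c t) U W = berger_metric \<kappa> \<tau> (c t) W U" for U W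
    by (simp add: berger_metric_def inner_commute mult_ac)
  have sk: "times_i (Y t) \<bullet> Z t = - (times_i (Z t) \<bullet> Y t)"
    by (metis times_i_skew inner_commute)
  have "((\<lambda>s. berger_metric \<kappa> \<tau> (c s) (Y s) (Z s)) has_real_derivative
     4 / \<kappa> * ((Y t \<bullet> Z' + Y' \<bullet> Z t) + (4 * \<tau>\<^sup>2 / \<kappa> - 1) *
       ((Y t \<bullet> times_i c' + Y' \<bullet> times_i (c t)) * (Z t \<bullet> times_i (c t))
        + (Z t \<bullet> times_i c' + Z' \<bullet> times_i (c t)) * (Y t \<bullet> times_i (c t))))) (at t)"
    unfolding berger_metric_def mult.assoc
    by (intro DERIV_cmult DERIV_add DERIV_mult ip dY dZ dI)
  then show "((\<lambda>s. berger_metric \<kappa> \<tau> (c s) (Y s) (Z s)) has_real_derivative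
           berger_metric \<kappa> \<tau> (c t) (Y' + berger_Gamma \<kappa> \<tau> (c t) c' (Y t)) (Z t) +
           berger_metric \<kappa> \<tau> (c t) (Y t) (Z' + berger_Gamma \<kappa> \<tau> (c t) c' (Z t))) (at t)"
    apply (rule DERIV_cong)
    apply (subst sym[of "Y t"])
    apply (subst G1, use tan in simp, use tan in simp)+
    apply (simp add: sk)
    apply (simp add: inner_commute algebra_simps add_divide_distrib diff_divide_distrib)
    done
qed

lemma levi_civita_unique:
  assumes "\<kappa> > 0" "\<tau> \<noteq> 0" and G1: "levi_civita \<kappa> \<tau> \<Gamma>" and G2: "levi_civita \<kappa> \<tau> \<Gamma>'"
    and p: "p \<in> S3" and X: "X \<bullet> p = 0" and Y: "Y \<bullet> p = 0"
  shows "\<Gamma> p X Y = \<Gamma>' p X Y"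
proof -
  let ?G = "berger_metric \<kappa> \<tau> p"
  have pp: "p \<bullet> p = 1" using p by (simp add: S3_inner)
  define D where "D U V = \<Gamma> p U V - \<Gamma>' p U V" for U V
  have main: "D U V \<bullet> p = 0 \<and> ?G (D U V) W + ?G V (D U W) = 0"
    if T: "U \<bullet> p = 0" "V \<bullet> p = 0" "W \<bullet> p = 0" for U V W
  proof -
    define b where "b t = p + t *\<^sub>R U" for t :: real
    have bb: "b t \<bullet> b t = 1 + t\<^sup>2 * (U \<bullet> U)" for t
      using pp T by (simp add: b_def inner_simps inner_commute power2_eq_square)
    have pos: "b t \<bullet> b t > 0" for t
      unfolding bb by (simp add: add_pos_nonneg)
    define c where "c t = (1 / sqrt (b t \<bullet> b t)) *\<^sub>R b t" for t
    define F where "F A t = A - (A \<bullet> c t) *\<^sub>R c t" for A t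
    have cc: "c t \<bullet> c t = 1" for t using pos[of t]
      by (simp add: c_def field_simps)
    have c0: "c 0 = p" using pp by (simp add: c_def b_def norm_eq_1)
    have db: "(b has_vector_derivative U) (at 0)"
      unfolding b_def[abs_def] by (auto intro!: derivative_eq_intros)
    have dn: "((\<lambda>t. 1 / sqrt (b t \<bullet> b t)) has_real_derivative 0) (at 0)"
      unfolding bb by (auto intro!: derivative_eq_intros)
    have "(c has_vector_derivative ((1 / sqrt (b 0 \<bullet> b 0)) *\<^sub>R U + 0 *\<^sub>R b 0)) (at 0)"
      unfolding c_def[abs_def] by (rule has_vector_derivative_scaleR[OF dn db])
    then have dc: "(c has_vector_derivative U) (at 0)"
      by (simp add: bb)
    have "\<exists>A'. (F A has_vector_derivative A') (at 0)" for A
    proof -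
      have "((\<lambda>t. A \<bullet> c t) has_vector_derivative A \<bullet> U) (at 0)"
        by (rule bounded_linear.has_vector_derivative[OF bounded_linear_inner_right dc])
      then have 1: "((\<lambda>t. A \<bullet> c t) has_real_derivative A \<bullet> U) (at 0)"
        by (simp add: has_real_derivative_iff_has_vector_derivative)
      show ?thesis unfolding F_def[abs_def]
        using has_vector_derivative_diff[OF has_vector_derivative_const[of A]
            has_vector_derivative_scaleR[OF 1 dc]] by blast
    qed
    then obtain V' W' where dV: "(F V has_vector_derivative V') (at 0)"
      and dW: "(F W has_vector_derivative W') (at 0)" by meson
    have F: "F A t \<bullet> c t = 0" for A t by (simp add: F_def inner_simps cc)
    have F0: "F V 0 = V" "F W 0 = W" using T by (simp_all add: F_def c0)
    have ball: "\<forall>s. c s \<in> S3 \<and> F V s \<bullet> c s = 0 \<and> F W s \<bullet> c s = 0"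
      using F cc by (simp add: norm_eq_1)
    have R: "(V' + \<Gamma>0 p U V) \<bullet> p = 0 \<and>
       ((\<lambda>s. berger_metric \<kappa> \<tau> (c s) (F V s) (F W s)) has_real_derivative
           ?G (V' + \<Gamma>0 p U V) W + ?G V (W' + \<Gamma>0 p U W)) (at 0)"
      if "levi_civita \<kappa> \<tau> \<Gamma>0" for \<Gamma>0
      using that[unfolded levi_civita_def, THEN conjunct2, rule_format,
          where c = c and Y = "F V" and Z = "F W" and t = 0 and c' = U and Y' = V' and Z' = W']
        ball dc dV dW by (simp add: c0 F0)
    have "(V' + \<Gamma> p U V) \<bullet> p = (V' + \<Gamma>' p U V) \<bullet> p" using R[OF G1] R[OF G2] by simp
    then have 1: "D U V \<bullet> p = 0" by (simp add: D_def inner_simps)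
    have "?G (V' + \<Gamma> p U V) W + ?G V (W' + \<Gamma> p U W) = ?G (V' + \<Gamma>' p U V) W + ?G V (W' + \<Gamma>' p U W)"
      using R[OF G1] R[OF G2] DERIV_unique by blast
    then have "?G (D U V) W + ?G V (D U W) = 0"
      using assms(1) by (simp add: berger_metric_def D_def inner_simps field_simps)
    with 1 show ?thesis by simp
  qed
  have sym: "D U V = D V U" if "U \<bullet> p = 0" "V \<bullet> p = 0" for U V
    using G1 G2 that p unfolding levi_civita_def D_def by (metis (no_types, lifting))
  have gs: "?G U V = ?G V U" for U V
    by (simp add: berger_metric_def inner_commute mult_ac)
  define W where "W = D X Y"
  have W: "W \<bullet> p = 0" using main[OF X Y Y] by (simp add: W_def)
  have z: "?G (D X Y) W = 0"
    using main[OF X Y W] main[OF W X Y] main[OF Y W X] sym[OF X Y] sym[OF X W] sym[OF Y W] gs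
    by (smt (verit))
  have "?G W W = (4 / \<kappa>) * ((W \<bullet> W - (W \<bullet> times_i p)\<^sup>2) + 4 * \<tau>\<^sup>2 / \<kappa> * (W \<bullet> times_i p)\<^sup>2)"
    by (simp add: berger_metric_def power2_eq_square algebra_simps)
  then have *: "(W \<bullet> W - (W \<bullet> times_i p)\<^sup>2) + 4 * \<tau>\<^sup>2 / \<kappa> * (W \<bullet> times_i p)\<^sup>2 = 0"
    using z assms(1) by (simp add: W_def)
  have cs: "(W \<bullet> times_i p)\<^sup>2 \<le> W \<bullet> W"
    using Cauchy_Schwarz_ineq[of W "times_i p"] pp by simp
  have "0 \<le> 4 * \<tau>\<^sup>2 / \<kappa> * (W \<bullet> times_i p)\<^sup>2" using assms(1) by simp
  with * cs have "4 * \<tau>\<^sup>2 / \<kappa> * (W \<bullet> times_i p)\<^sup>2 = 0" "W \<bullet> W = (W \<bullet> times_i p)\<^sup>2" by linarith+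
  then have "W = 0" using assms(1,2) by simp
  then show ?thesis by (simp add: W_def D_def)
qed

text \<open>The Riemannian submersion onto the round sphere of curvature \<open>\<kappa>\<close>, with fibres tangent to \<open>\<xi>\<close>.\<close>

definition hopf_map :: "real \<Rightarrow> C2 \<Rightarrow> complex \<times> real" where
  "hopf_map \<kappa> p = (1 / sqrt \<kappa>) *\<^sub>R (2 * fst p * cnj (snd p), (cmod (fst p))\<^sup>2 - (cmod (snd p))\<^sup>2)"

definition hopf_deriv :: "real \<Rightarrow> C2 \<Rightarrow> C2 \<Rightarrow> complex \<times> real" where
  "hopf_deriv \<kappa> p X = (2 / sqrt \<kappa>) *\<^sub>R (fst X * cnj (snd p) + fst p * cnj (snd X), fst X \<bullet> fst p - snd X \<bullet> snd p)"

lemma hopf_map_submersion: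
  assumes "\<kappa> > 0" "\<tau> \<noteq> 0" "p \<in> S3"
  shows "(hopf_map \<kappa> has_derivative hopf_deriv \<kappa> p) (at p)"
    and "hopf_deriv \<kappa> p (berger_xi \<kappa> \<tau> p) = 0"
    and "\<lbrakk>X \<bullet> p = 0; Y \<bullet> p = 0; berger_metric \<kappa> \<tau> p X (berger_xi \<kappa> \<tau> p) = 0\<rbrakk> \<Longrightarrow>
           hopf_deriv \<kappa> p X \<bullet> hopf_deriv \<kappa> p Y = berger_metric \<kappa> \<tau> p X Y"
proof -
  have pp: "p \<bullet> p = 1" using assms by (simp add: S3_inner)
  have "((\<lambda>p. (2 * fst p * cnj (snd p), fst p \<bullet> fst p - snd p \<bullet> snd p)) has_derivative
      (\<lambda>X. 2 *\<^sub>R (fst X * cnj (snd p) + fst p * cnj (snd X), fst X \<bullet> fst p - snd X \<bullet> snd p))) (at p)"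
    by (auto intro!: derivative_eq_intros bounded_linear.has_derivative[OF bounded_linear_cnj]
        simp: fun_eq_iff scaleR_conv_of_real inner_commute algebra_simps)
  then have "((\<lambda>p. (1 / sqrt \<kappa>) *\<^sub>R (2 * fst p * cnj (snd p), fst p \<bullet> fst p - snd p \<bullet> snd p))
     has_derivative (\<lambda>X. (1 / sqrt \<kappa>) *\<^sub>R 2 *\<^sub>R
       (fst X * cnj (snd p) + fst p * cnj (snd X), fst X \<bullet> fst p - snd X \<bullet> snd p))) (at p)"
    by (rule has_derivative_scaleR_right)
  then show "(hopf_map \<kappa> has_derivative hopf_deriv \<kappa> p) (at p)"
    by (simp add: hopf_map_def[abs_def] hopf_deriv_def[abs_def] power2_norm_eq_inner del: scaleR_Pair)
  show "hopf_deriv \<kappa> p (berger_xi \<kappa> \<tau> p) = 0"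
    by (simp add: hopf_deriv_def berger_xi_def times_i_def prod_eq_iff complex_eq_iff inner_complex_def)
  assume X: "X \<bullet> p = 0" and Y: "Y \<bullet> p = 0" and h: "berger_metric \<kappa> \<tau> p X (berger_xi \<kappa> \<tau> p) = 0"
  have hX: "X \<bullet> times_i p = 0"
  proof -
    have "berger_metric \<kappa> \<tau> p X (berger_xi \<kappa> \<tau> p) = (4 * \<tau> / \<kappa>) * (X \<bullet> times_i p)"
      using assms pp by (simp add: berger_metric_def berger_xi_def field_simps power2_eq_square)
    then show ?thesis using h assms by simp
  qed
  have id: "(fst X * cnj (snd p) + fst p * cnj (snd X), fst X \<bullet> fst p - snd X \<bullet> snd p)
     \<bullet> (fst Y * cnj (snd p) + fst p * cnj (snd Y), fst Y \<bullet> fst p - snd Y \<bullet> snd p)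
     = (p \<bullet> p) * (X \<bullet> Y) - (X \<bullet> times_i p) * (Y \<bullet> times_i p)"
    by (simp add: times_i_def inner_prod_def inner_complex_def) (simp add: algebra_simps)
  show "hopf_deriv \<kappa> p X \<bullet> hopf_deriv \<kappa> p Y = berger_metric \<kappa> \<tau> p X Y"
    using assms(1) unfolding hopf_deriv_def inner_scaleR_left inner_scaleR_right id
    by (simp add: pp hX berger_metric_def field_simps)
qed

lemma hopf_map_image:
  assumes "\<kappa> > 0"
  shows "hopf_map \<kappa> ` S3 = sphere 0 (1 / sqrt \<kappa>)"
proof (intro equalityI subsetI)
  fix q assume "q \<in> hopf_map \<kappa> ` S3"
  then obtain p where p: "p \<in> S3" "q = hopf_map \<kappa> p" by auto
  have "(p \<bullet> p)\<^sup>2 = 1" using p by (simp add: S3_inner)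
  then have "(norm (2 * fst p * cnj (snd p), (cmod (fst p))\<^sup>2 - (cmod (snd p))\<^sup>2))\<^sup>2 = 1"
    by (simp add: norm_Pair inner_prod_def norm_mult dot_square_norm)
      (simp add: power2_eq_square algebra_simps)
  then have "norm (2 * fst p * cnj (snd p), (cmod (fst p))\<^sup>2 - (cmod (snd p))\<^sup>2) = 1"
    by (metis norm_ge_zero power2_eq_1_iff neg_0_le_iff_le not_one_le_zero)
  then show "q \<in> sphere 0 (1 / sqrt \<kappa>)"
    using assms p by (simp add: hopf_map_def del: scaleR_Pair)
next
  fix q :: "complex \<times> real" assume "q \<in> sphere 0 (1 / sqrt \<kappa>)"
  then have nq: "norm (sqrt \<kappa> *\<^sub>R q) = 1" using assms by simp
  obtain u h where uh: "sqrt \<kappa> *\<^sub>R q = (u, h)" by (cases "sqrt \<kappa> *\<^sub>R q")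
  have q: "q = (1 / sqrt \<kappa>) *\<^sub>R (u, h)" using assms uh[symmetric] by simp
  have uh1: "(cmod u)\<^sup>2 + h\<^sup>2 = 1"
    using nq unfolding uh by (simp add: norm_Pair)
  have h: "\<bar>h\<bar> \<le> 1" using uh1 by (metis abs_le_square_iff abs_one le_add_same_cancel2 one_power2 zero_le_power2)
  show "q \<in> hopf_map \<kappa> ` S3"
  proof (cases "h = -1")
    case True
    then have "hopf_map \<kappa> (0, 1) = q" using uh1 by (simp add: q hopf_map_def)
    then show ?thesis by (force simp: norm_Pair)
  next
    case False
    define z where "z = sqrt ((1 + h) / 2)"
    have z: "z > 0" "z\<^sup>2 = (1 + h) / 2" using False h by (auto simp: z_def)
    define w where "w = cnj u / of_real (2 * z)"
    have "(cmod w)\<^sup>2 = (cmod u)\<^sup>2 / (4 * z\<^sup>2)"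
      using z by (simp add: w_def norm_divide norm_mult power_divide power_mult_distrib)
    also have "\<dots> = (1 - h) * (1 + h) / (2 * (1 + h))"
    proof -
      have "(cmod u)\<^sup>2 = (1 - h) * (1 + h)" using uh1 by (simp add: algebra_simps power2_eq_square)
      moreover have "4 * z\<^sup>2 = 2 * (1 + h)" using z(2) by simp
      ultimately show ?thesis by simp
    qed
    also have "\<dots> = (1 - h) / 2"
    proof -
      have "1 + h \<noteq> 0" using False by linarith
      then show ?thesis by (simp only: mult.commute[of 2] times_divide_times_eq[symmetric]
          mult.commute[of "1 - h"] divide_self) simp
    qed
    finally have w: "(cmod w)\<^sup>2 = (1 - h) / 2" .
    have "hopf_map \<kappa> (of_real z, w) = q"
      using z by (simp add: q hopf_map_def w field_simps) (simp add: w_def)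
    moreover have "(complex_of_real z, w) \<in> S3"
      using z w by (simp add: norm_Pair field_simps)
    ultimately show ?thesis by (metis image_eqI)
  qed
qed

lemma simply_connected_S3: "simply_connected S3"
  by (rule simply_connected_sphere) simp

text \<open>Homogeneity: orientation-preserving isometries act transitively.\<close>

lemma berger_homogeneous:
  assumes "p \<in> S3" "q \<in> S3"
  obtains A where "linear A" "A ` S3 = S3" "A p = q"
    "\<And>x X Y. berger_metric \<kappa> \<tau> (A x) (A X) (A Y) = berger_metric \<kappa> \<tau> x X Y"
    "\<And>x. berger_e1 \<kappa> (A x) = A (berger_e1 \<kappa> x)"
    "\<And>x. berger_e2 \<kappa> (A x) = A (berger_e2 \<kappa> x)"
    "\<And>x. berger_xi \<kappa> \<tau> (A x) = A (berger_xi \<kappa> \<tau> x)"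
proof -
  define L :: "C2 \<Rightarrow> C2 \<Rightarrow> C2" where
    "L a x = (fst a * fst x - cnj (snd a) * snd x, snd a * fst x + cnj (fst a) * snd x)" for a x
  define L' :: "C2 \<Rightarrow> C2" where "L' a = (cnj (fst a), - snd a)" for a
  define A where "A x = L q (L (L' p) x)" for x
  have lin: "linear (L a)" for a
    by (rule linearI) (simp_all add: L_def prod_eq_iff algebra_simps)
  have L'S: "L' p \<in> S3" using assms by (simp add: L'_def norm_Pair norm_prod_def)
  have inn: "L a X \<bullet> L a Y = X \<bullet> Y" if "a \<in> S3" for a X Y
  proof -
    have "L a X \<bullet> L a Y = (a \<bullet> a) * (X \<bullet> Y)"
      by (simp add: L_def inner_prod_def inner_complex_def algebra_simps)
    then show ?thesis using that by (simp add: S3_inner)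
  qed
  have ti: "times_i (L a X) = L a (times_i X)" for a X
    by (simp add: L_def times_i_def algebra_simps)
  have e1: "berger_e1 \<kappa> (L a x) = L a (berger_e1 \<kappa> x)" for a x
    by (simp add: L_def berger_e1_def prod_eq_iff algebra_simps)
  have linA: "linear A" unfolding A_def[abs_def] using linear_compose[OF lin lin] by (simp add: o_def)
  have innA: "A X \<bullet> A Y = X \<bullet> Y" for X Y by (simp only: A_def inn[OF assms(2)] inn[OF L'S])
  have tiA: "times_i (A X) = A (times_i X)" for X by (simp add: A_def ti)
  have e1A: "berger_e1 \<kappa> (A x) = A (berger_e1 \<kappa> x)" for x by (simp add: A_def e1)
  have "L (L' p) p = (of_real (p \<bullet> p), 0)"
    by (simp add: L_def L'_def inner_prod_def inner_complex_def complex_eq_iff algebra_simps)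
  then have Ap: "A p = q" using assms by (simp add: A_def L_def S3_inner)
  have orth: "orthogonal_transformation A"
    using linA innA by (simp add: orthogonal_transformation_def)
  have im: "A ` S3 = S3"
  proof (intro equalityI subsetI)
    show "y \<in> S3" if "y \<in> A ` S3" for y
      using that orthogonal_transformation_norm[OF orth] by auto
    show "y \<in> A ` S3" if "y \<in> S3" for y
    proof -
      obtain x where "y = A x" using orthogonal_transformation_surj[OF orth] by (meson surjD)
      then show ?thesis using that orthogonal_transformation_norm[OF orth] by auto
    qed
  qed
  show thesis
    by (rule that[OF linA im Ap])
      (simp_all add: berger_metric_def innA tiA e1A berger_e2_def berger_xi_def
        linear_neg[OF linA] linear_scale[OF linA])
qed

lemma berger_frame_expand:
  assumes "\<kappa> > 0" "\<tau> \<noteq> 0" "p \<in> S3" "X \<bullet> p = 0"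
  shows "X = berger_metric \<kappa> \<tau> p X (berger_e1 \<kappa> p) *\<^sub>R berger_e1 \<kappa> p
    + berger_metric \<kappa> \<tau> p X (berger_e2 \<kappa> p) *\<^sub>R berger_e2 \<kappa> p
    + berger_metric \<kappa> \<tau> p X (berger_xi \<kappa> \<tau> p) *\<^sub>R berger_xi \<kappa> \<tau> p"
proof -
  define e where "e = (- cnj (snd p), cnj (fst p))"
  have pp: "p \<bullet> p = 1" using assms by (simp add: S3_inner)
  have ep: "e \<bullet> times_i p = 0" "e \<bullet> p = 0"
    by (simp_all add: e_def times_i_def inner_prod_def inner_complex_def)
  have e1: "berger_e1 \<kappa> p = (sqrt \<kappa> / 2) *\<^sub>R e" by (simp add: berger_e1_def e_def)
  have e2: "berger_e2 \<kappa> p = - ((sqrt \<kappa> / 2) *\<^sub>R times_i e)"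
    by (simp add: berger_e2_def e1 times_i_scaleR)
  have s: "sqrt \<kappa> * (sqrt \<kappa> * x) = \<kappa> * x" for x
    using assms by (metis mult.assoc real_sqrt_mult_self abs_of_pos)
  have g: "berger_metric \<kappa> \<tau> p X (berger_e1 \<kappa> p) = 2 * sqrt \<kappa> / \<kappa> * (X \<bullet> e)"
    "berger_metric \<kappa> \<tau> p X (berger_e2 \<kappa> p) = - 2 * sqrt \<kappa> / \<kappa> * (X \<bullet> times_i e)"
    by (simp_all add: berger_metric_def e1 e2 ep)
  have g3: "berger_metric \<kappa> \<tau> p X (berger_xi \<kappa> \<tau> p) = (4 * \<tau> / \<kappa>) * (X \<bullet> times_i p)"
    using assms pp by (simp add: berger_metric_def berger_xi_def field_simps power2_eq_square)
  have "(p \<bullet> p) *\<^sub>R X = (X \<bullet> p) *\<^sub>R p + (X \<bullet> times_i p) *\<^sub>R times_i p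
    + (X \<bullet> e) *\<^sub>R e + (X \<bullet> times_i e) *\<^sub>R times_i e"
    by (simp add: e_def times_i_def inner_prod_def inner_complex_def prod_eq_iff complex_eq_iff algebra_simps)
  then have X: "X = (X \<bullet> times_i p) *\<^sub>R times_i p + (X \<bullet> e) *\<^sub>R e + (X \<bullet> times_i e) *\<^sub>R times_i e"
    using assms pp by simp
  have "berger_metric \<kappa> \<tau> p X (berger_e1 \<kappa> p) *\<^sub>R berger_e1 \<kappa> p = (X \<bullet> e) *\<^sub>R e"
    "berger_metric \<kappa> \<tau> p X (berger_e2 \<kappa> p) *\<^sub>R berger_e2 \<kappa> p = (X \<bullet> times_i e) *\<^sub>R times_i e"
    using assms(1) unfolding g by (simp_all add: e1 e2) (simp_all add: s mult_ac)
  moreover have "berger_metric \<kappa> \<tau> p X (berger_xi \<kappa> \<tau> p) *\<^sub>R berger_xi \<kappa> \<tau> p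
      = (X \<bullet> times_i p) *\<^sub>R times_i p"
    using assms(1,2) by (simp add: g3) (simp add: berger_xi_def)
  ultimately show ?thesis using X by (simp add: add_ac)
qed

text \<open>
  The normalised cross product of a basis \<open>X\<close>, \<open>Y\<close> of a plane is the unit normal \<open>N\<close> for which
  \<open>V \<mapsto> N \<times> V\<close> is the rotation by \<open>\<pi> / 2\<close> in the sense from \<open>X\<close> to \<open>Y\<close>.
\<close>

definition berger_normal :: "real \<Rightarrow> real \<Rightarrow> C2 \<Rightarrow> C2 \<Rightarrow> C2 \<Rightarrow> C2" where
  "berger_normal \<kappa> \<tau> p X Y = (let n = berger_cross \<kappa> \<tau> p X Y in
     (1 / sqrt (berger_metric \<kappa> \<tau> p n n)) *\<^sub>R n)"

lemma berger_normal_rotation: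
  fixes \<kappa> \<tau> p
  defines "G \<equiv> berger_metric \<kappa> \<tau> p"
  assumes "\<kappa> > 0" "\<tau> \<noteq> 0" "p \<in> S3" and X: "X \<bullet> p = 0" and Y: "Y \<bullet> p = 0"
    and gram: "G X X * G Y Y - (G X Y)\<^sup>2 > 0"
  defines "N \<equiv> berger_normal \<kappa> \<tau> p X Y"
  shows "N \<bullet> p = 0" "G N N = 1" "G N X = 0" "G N Y = 0"
    and "\<And>V. V \<in> span {X, Y} \<Longrightarrow> berger_cross \<kappa> \<tau> p N V \<bullet> p = 0 \<and>
           G N (berger_cross \<kappa> \<tau> p N V) = 0 \<and> G V (berger_cross \<kappa> \<tau> p N V) = 0 \<and>
           G (berger_cross \<kappa> \<tau> p N V) (berger_cross \<kappa> \<tau> p N V) = G V V"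
    and "G (berger_cross \<kappa> \<tau> p N X) Y > 0"
proof -
  let ?e = "berger_e1 \<kappa> p" and ?f = "berger_e2 \<kappa> p" and ?x = "berger_xi \<kappa> \<tau> p"
  note fr = berger_frame[OF assms(2-4), folded G_def]
  have lin: "G (A + B) C = G A C + G B C" "G (a *\<^sub>R A) C = a * G A C"
    "G C (A + B) = G C A + G C B" "G C (a *\<^sub>R A) = a * G C A" "G A B = G B A" for A B C a
    by (simp_all add: G_def berger_metric_def inner_simps algebra_simps inner_commute
        add_divide_distrib diff_divide_distrib)
  have coord: "G (a *\<^sub>R ?e + b *\<^sub>R ?f + c *\<^sub>R ?x) ?e = a \<and> G (a *\<^sub>R ?e + b *\<^sub>R ?f + c *\<^sub>R ?x) ?f = b
     \<and> G (a *\<^sub>R ?e + b *\<^sub>R ?f + c *\<^sub>R ?x) ?x = c" for a b c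
    using fr by (simp add: lin(1-4) lin(5)[of ?f ?e] lin(5)[of ?x ?e] lin(5)[of ?x ?f])
  have tan: "(a *\<^sub>R ?e + b *\<^sub>R ?f + c *\<^sub>R ?x) \<bullet> p = 0" for a b c
    using fr by (simp add: inner_simps)
  have GG: "G A B = G A ?e * G B ?e + G A ?f * G B ?f + G A ?x * G B ?x" if "A \<bullet> p = 0" for A B
    apply (subst berger_frame_expand[OF assms(2-4) that, folded G_def])
    apply (simp only: lin(1,2))
    apply (simp add: lin(5)[of B])
    done
  have ct: "berger_cross \<kappa> \<tau> p A B \<bullet> p = 0" for A B
    by (simp add: berger_cross_def Let_def tan)
  have c1: "G (berger_cross \<kappa> \<tau> p A B) ?e = G A ?f * G B ?x - G A ?x * G B ?f"
    and c2: "G (berger_cross \<kappa> \<tau> p A B) ?f = G A ?x * G B ?e - G A ?e * G B ?x"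
    and c3: "G (berger_cross \<kappa> \<tau> p A B) ?x = G A ?e * G B ?f - G A ?f * G B ?e" for A B
    unfolding berger_cross_def Let_def G_def[symmetric] using coord by blast+
  define M where "M = berger_cross \<kappa> \<tau> p X Y"
  define m where "m = sqrt (G M M)"
  note cM = c1[of X Y, folded M_def] c2[of X Y, folded M_def] c3[of X Y, folded M_def]
  have Mt: "M \<bullet> p = 0" by (simp add: M_def ct)
  have "G M M = G X X * G Y Y - (G X Y)\<^sup>2"
    unfolding GG[OF Mt, of M] GG[OF X, of X] GG[OF X, of Y] GG[OF Y, of Y] cM
    by (simp add: power2_eq_square algebra_simps)
  then have M0: "G M M > 0" using gram by simp
  then have m: "m > 0" "m * m = G M M" by (simp_all add: m_def)
  have N: "N = (1 / m) *\<^sub>R M"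
    by (simp add: N_def berger_normal_def Let_def M_def m_def G_def)
  show Nt: "N \<bullet> p = 0" using Mt by (simp add: N)
  show NN: "G N N = 1" using m by (simp add: N lin(2,4)) (simp add: field_simps m_def)
  have MX: "G M X = 0" "G M Y = 0" 
    unfolding GG[OF Mt, of X] GG[OF Mt, of Y] cM by (simp_all add: algebra_simps)
  then show NX: "G N X = 0" "G N Y = 0" by (simp_all add: N lin(2))
  show "G (berger_cross \<kappa> \<tau> p N X) Y > 0"
  proof -
    have "G (berger_cross \<kappa> \<tau> p N X) Y = (1 / m) * G M M"
      unfolding GG[OF ct[of N X], of Y] c1[of N X] c2[of N X] c3[of N X]
      unfolding GG[OF Mt, of M] N lin(2) cM
      by (simp add: algebra_simps)
    then show ?thesis using m M0 by simp
  qed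
  fix V assume "V \<in> span {X, Y}"
  then obtain a b where V: "V = a *\<^sub>R X + b *\<^sub>R Y"
    by (auto simp: span_breakdown_eq) (metis add.commute diff_add_cancel)
  have Vt: "V \<bullet> p = 0" using X Y by (simp add: V inner_simps)
  have NV: "G N V = 0" using NX by (simp add: V lin(3,4))
  have "G (berger_cross \<kappa> \<tau> p N V) (berger_cross \<kappa> \<tau> p N V) = G N N * G V V - (G N V)\<^sup>2"
    unfolding GG[OF ct[of N V], of "berger_cross \<kappa> \<tau> p N V"] GG[OF Nt, of N] GG[OF Nt, of V]
      GG[OF Vt, of V] c1[of N V] c2[of N V] c3[of N V]
    by (simp add: power2_eq_square algebra_simps)
  moreover have "G N (berger_cross \<kappa> \<tau> p N V) = 0" "G V (berger_cross \<kappa> \<tau> p N V) = 0"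
    unfolding GG[OF Nt, of "berger_cross \<kappa> \<tau> p N V"] GG[OF Vt, of "berger_cross \<kappa> \<tau> p N V"]
      c1[of N V] c2[of N V] c3[of N V] by (simp_all add: algebra_simps)
  ultimately show "berger_cross \<kappa> \<tau> p N V \<bullet> p = 0 \<and>
           G N (berger_cross \<kappa> \<tau> p N V) = 0 \<and> G V (berger_cross \<kappa> \<tau> p N V) = 0 \<and>
           G (berger_cross \<kappa> \<tau> p N V) (berger_cross \<kappa> \<tau> p N V) = G V V"
    using NN NV ct by simp
qed


section \<open>Local geometry of an immersed patch\<close>

text \<open>
  Throughout, \<open>r\<close> is an immersion of an open subset of the parameter plane \<open>complex\<close> into the sphere.
  Tangent vectors of the surface are written in the coordinates of the parameter plane, i.e. a vector
  \<open>v :: complex\<close> at \<open>z\<close> stands for \<open>patch_d r z v\<close>; the basis \<open>1\<close>, \<open>\<i>\<close> stands for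
  \<open>\<partial>\<^sub>x\<close>, \<open>\<partial>\<^sub>y\<close>.
\<close>

definition patch_d :: "(complex \<Rightarrow> C2) \<Rightarrow> complex \<Rightarrow> complex \<Rightarrow> C2" where
  "patch_d r z v = frechet_derivative r (at z) v"

definition patch_metric :: "real \<Rightarrow> real \<Rightarrow> (complex \<Rightarrow> C2) \<Rightarrow> complex \<Rightarrow> complex \<Rightarrow> complex \<Rightarrow> real" where
  "patch_metric \<kappa> \<tau> r z v w = berger_metric \<kappa> \<tau> (r z) (patch_d r z v) (patch_d r z w)"

definition patch_normal :: "real \<Rightarrow> real \<Rightarrow> (complex \<Rightarrow> C2) \<Rightarrow> complex \<Rightarrow> C2" where
  "patch_normal \<kappa> \<tau> r z = berger_normal \<kappa> \<tau> (r z) (patch_d r z 1) (patch_d r z \<i>)"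

definition shape_operator :: "real \<Rightarrow> real \<Rightarrow> (complex \<Rightarrow> C2) \<Rightarrow> complex \<Rightarrow> complex \<Rightarrow> complex" where
  "shape_operator \<kappa> \<tau> r z v =
     (THE w. patch_d r z w = - berger_nabla \<kappa> \<tau> r (patch_normal \<kappa> \<tau> r) z v)"

definition endo_trace :: "('a::euclidean_space \<Rightarrow> 'a) \<Rightarrow> real" where
  "endo_trace L = (\<Sum>b\<in>Basis. L b \<bullet> b)"

definition mean_curvature :: "real \<Rightarrow> real \<Rightarrow> (complex \<Rightarrow> C2) \<Rightarrow> complex \<Rightarrow> real" where
  "mean_curvature \<kappa> \<tau> r z = endo_trace (shape_operator \<kappa> \<tau> r z) / 2"

text \<open>
  An element \<open>u + \<i> v\<close> of the complexification of a real vector space is the pair \<open>(u, v)\<close>; in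
  particular the factor \<open>\<i>\<close> of the complexification is not multiplication by \<open>\<i>\<close> in the parameter plane.
\<close>

definition complexify_map :: "('a \<Rightarrow> 'b) \<Rightarrow> 'a \<times> 'a \<Rightarrow> 'b \<times> 'b" where
  "complexify_map L X = (L (fst X), L (snd X))"

definition complexify_form :: "('a \<Rightarrow> 'a \<Rightarrow> real) \<Rightarrow> 'a \<times> 'a \<Rightarrow> 'a \<times> 'a \<Rightarrow> complex" where
  "complexify_form B X Y =
     Complex (B (fst X) (fst Y) - B (snd X) (snd Y)) (B (fst X) (snd Y) + B (snd X) (fst Y))"

text \<open>\<open>\<partial>\<^sub>\<zeta> = (\<partial>\<^sub>x - \<i> \<partial>\<^sub>y) / 2\<close>\<close>

definition d_zeta :: "complex \<times> complex" where
  "d_zeta = (1 / 2, - \<i> / 2)"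

definition conformal_on :: "real \<Rightarrow> real \<Rightarrow> (complex \<Rightarrow> C2) \<Rightarrow> complex set \<Rightarrow> bool" where
  "conformal_on \<kappa> \<tau> r U \<longleftrightarrow> (\<forall>z\<in>U. \<exists>l>0. \<forall>v w. patch_metric \<kappa> \<tau> r z v w = l * (v \<bullet> w))"

definition conformal_factor :: "real \<Rightarrow> real \<Rightarrow> (complex \<Rightarrow> C2) \<Rightarrow> complex \<Rightarrow> real" where
  "conformal_factor \<kappa> \<tau> r z = patch_metric \<kappa> \<tau> r z 1 1"

definition Q_AR :: "real \<Rightarrow> real \<Rightarrow> (complex \<Rightarrow> C2) \<Rightarrow> complex \<Rightarrow> complex" where
  "Q_AR \<kappa> \<tau> r z =
     (let k = \<kappa> - 4 * \<tau>\<^sup>2;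
          p = complexify_form (patch_metric \<kappa> \<tau> r z)
                (complexify_map (shape_operator \<kappa> \<tau> r z) d_zeta) d_zeta;
          A = complexify_form (berger_metric \<kappa> \<tau> (r z))
                (berger_xi \<kappa> \<tau> (r z), 0) (complexify_map (patch_d r z) d_zeta)
      in 2 * (complex_of_real (mean_curvature \<kappa> \<tau> r z) + \<i> * complex_of_real \<tau>) * p
         - complex_of_real k * A\<^sup>2)"

definition AR_norm :: "real \<Rightarrow> real \<Rightarrow> (complex \<Rightarrow> C2) \<Rightarrow> complex \<Rightarrow> real" where
  "AR_norm \<kappa> \<tau> r z = cmod (Q_AR \<kappa> \<tau> r z) / conformal_factor \<kappa> \<tau> r z"

definition dH_norm :: "real \<Rightarrow> real \<Rightarrow> (complex \<Rightarrow> C2) \<Rightarrow> complex \<Rightarrow> real" where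
  "dH_norm \<kappa> \<tau> r z =
     (let dH = frechet_derivative (mean_curvature \<kappa> \<tau> r) (at z)
      in sqrt (((dH 1)\<^sup>2 + (dH \<i>)\<^sup>2) / conformal_factor \<kappa> \<tau> r z))"


section \<open>Immersed surfaces\<close>

text \<open>\<open>Ck_on n f U\<close> and \<open>smooth_on f U\<close> are meant for open \<open>U\<close> in finite dimension.\<close>

primrec Ck_on :: "nat \<Rightarrow> ('a::real_normed_vector \<Rightarrow> 'b::real_normed_vector) \<Rightarrow> 'a set \<Rightarrow> bool" where
  "Ck_on 0 f U \<longleftrightarrow> continuous_on U f"
| "Ck_on (Suc n) f U \<longleftrightarrow> (\<forall>x\<in>U. f differentiable (at x)) \<and>
     (\<forall>v. Ck_on n (\<lambda>x. frechet_derivative f (at x) v) U)"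

definition smooth_on :: "('a::real_normed_vector \<Rightarrow> 'b::real_normed_vector) \<Rightarrow> 'a set \<Rightarrow> bool" where
  "smooth_on f U \<longleftrightarrow> (\<forall>n. Ck_on n f U)"

text \<open>
  Surfaces are described by local parametrisations \<open>(U, f)\<close>, \<open>f\<close> being the inverse of a chart; so
  the local parameter on \<open>f ` U\<close> is the identity of \<open>U\<close>.
\<close>

type_synonym 'm param = "complex set \<times> (complex \<Rightarrow> 'm)"

definition topological_param :: "'m topology \<Rightarrow> 'm param \<Rightarrow> bool" where
  "topological_param T c \<longleftrightarrow> (case c of (U, f) \<Rightarrow>
     open U \<and> openin T (f ` U) \<and> embedding_map (top_of_set U) T f)"

definition smooth_oriented_transition :: "'m param \<Rightarrow> 'm param \<Rightarrow> bool" where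
  "smooth_oriented_transition c d \<longleftrightarrow> (case (c, d) of ((U, f), (V, h)) \<Rightarrow>
     let W = {z \<in> U. f z \<in> h ` V}; \<phi> = (\<lambda>z. inv_into V h (f z)) in
       smooth_on \<phi> W \<and>
       (\<forall>z\<in>W. Im (cnj (frechet_derivative \<phi> (at z) 1) * frechet_derivative \<phi> (at z) \<i>) > 0))"

text \<open>The positively oriented local parameters of the oriented smooth structure given by an atlas:\<close>

definition oriented_param :: "'m topology \<Rightarrow> 'm param set \<Rightarrow> 'm param \<Rightarrow> bool" where
  "oriented_param T \<A> c \<longleftrightarrow> topological_param T c \<and>
     (\<forall>a\<in>\<A>. smooth_oriented_transition a c \<and> smooth_oriented_transition c a)"

definition oriented_surface :: "'m topology \<Rightarrow> 'm param set \<Rightarrow> bool" where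
  "oriented_surface T \<A> \<longleftrightarrow>
     Hausdorff_space T \<and> second_countable T \<and> connected_space T \<and>
     (\<forall>c\<in>\<A>. oriented_param T \<A> c) \<and> (\<Union>(U, f)\<in>\<A>. f ` U) = topspace T"

definition torus_space :: "'m topology \<Rightarrow> bool" where
  "torus_space T \<longleftrightarrow> T homeomorphic_space
     prod_topology (top_of_set (sphere (0::complex) 1)) (top_of_set (sphere (0::complex) 1))"

definition smooth_immersion :: "'m topology \<Rightarrow> 'm param set \<Rightarrow> ('m \<Rightarrow> C2) \<Rightarrow> bool" where
  "smooth_immersion T \<A> \<psi> \<longleftrightarrow> \<psi> ` topspace T \<subseteq> S3 \<and>
     (\<forall>(U, f)\<in>\<A>. smooth_on (\<psi> \<circ> f) U \<and> (\<forall>z\<in>U. inj (patch_d (\<psi> \<circ> f) z)))"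

definition constant_mean_curvature :: "real \<Rightarrow> real \<Rightarrow> 'm param set \<Rightarrow> ('m \<Rightarrow> C2) \<Rightarrow> bool" where
  "constant_mean_curvature \<kappa> \<tau> \<A> \<psi> \<longleftrightarrow>
     (\<exists>c. \<forall>(U, f)\<in>\<A>. \<forall>z\<in>U. mean_curvature \<kappa> \<tau> (\<psi> \<circ> f) z = c)"

definition conformal_param ::
    "real \<Rightarrow> real \<Rightarrow> 'm topology \<Rightarrow> 'm param set \<Rightarrow> ('m \<Rightarrow> C2) \<Rightarrow> 'm param \<Rightarrow> bool" where
  "conformal_param \<kappa> \<tau> T \<A> \<psi> c \<longleftrightarrow> oriented_param T \<A> c \<and> conformal_on \<kappa> \<tau> (\<psi> \<circ> snd c) (fst c)"

text \<open>
  \<open>|dH| \<le> h |Q|\<close> on the surface.  Every point lies in the domain of a conformal parameter (this is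
  required explicitly, so that the condition is not vacuous), and the inequality holds in each one.
\<close>

definition AR_inequality ::
    "real \<Rightarrow> real \<Rightarrow> 'm topology \<Rightarrow> 'm param set \<Rightarrow> ('m \<Rightarrow> C2) \<Rightarrow> ('m \<Rightarrow> real) \<Rightarrow> bool" where
  "AR_inequality \<kappa> \<tau> T \<A> \<psi> h \<longleftrightarrow> (\<forall>q\<in>topspace T.
     (\<exists>U f. conformal_param \<kappa> \<tau> T \<A> \<psi> (U, f) \<and> q \<in> f ` U) \<and>
     (\<forall>U f. \<forall>z\<in>U. conformal_param \<kappa> \<tau> T \<A> \<psi> (U, f) \<and> f z = q \<longrightarrow>
        dH_norm \<kappa> \<tau> (\<psi> \<circ> f) z \<le> h q * AR_norm \<kappa> \<tau> (\<psi> \<circ> f) z))"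

text \<open>
  Lengths for the induced metric are ambient lengths of the image curves.  Since \<open>\<psi>\<close> is an immersion,
  a continuous curve \<open>c\<close> is piecewise \<open>C\<^sup>1\<close> iff \<open>\<psi> \<circ> c\<close> is.  Integrability of the speed has to be
  demanded because \<open>valid_path\<close> does not bound the derivative at the break points.
\<close>

definition speed :: "real \<Rightarrow> real \<Rightarrow> (real \<Rightarrow> C2) \<Rightarrow> real \<Rightarrow> real" where
  "speed \<kappa> \<tau> \<gamma> t = sqrt (berger_metric \<kappa> \<tau> (\<gamma> t)
     (vector_derivative \<gamma> (at t)) (vector_derivative \<gamma> (at t)))"

definition induced_dist :: "real \<Rightarrow> real \<Rightarrow> 'm topology \<Rightarrow> ('m \<Rightarrow> C2) \<Rightarrow> 'm \<Rightarrow> 'm \<Rightarrow> real" where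
  "induced_dist \<kappa> \<tau> T \<psi> a b = Inf {integral {0..1} (speed \<kappa> \<tau> (\<psi> \<circ> c)) | c.
     pathin T c \<and> c 0 = a \<and> c 1 = b \<and> valid_path (\<psi> \<circ> c) \<and> speed \<kappa> \<tau> (\<psi> \<circ> c) integrable_on {0..1}}"

definition complete_surface :: "real \<Rightarrow> real \<Rightarrow> 'm topology \<Rightarrow> ('m \<Rightarrow> C2) \<Rightarrow> bool" where
  "complete_surface \<kappa> \<tau> T \<psi> \<longleftrightarrow> (\<forall>s. range s \<subseteq> topspace T \<and>
       (\<forall>e>0. \<exists>M. \<forall>m\<ge>M. \<forall>n\<ge>M. induced_dist \<kappa> \<tau> T \<psi> (s m) (s n) < e) \<longrightarrow>
     (\<exists>q\<in>topspace T. (\<lambda>n. induced_dist \<kappa> \<tau> T \<psi> (s n) q) \<longlonglongrightarrow> 0))"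

end

theory Submission
  imports Defs
begin

text \<open>
  The surface is a Hopf torus: the preimage under the Hopf fibration of a closed curve in the base
  sphere, here a curve of non-constant geodesic curvature \<open>k\<^sub>g\<close>.  On a Hopf torus
  the mean curvature is \<open>H = k\<^sub>g / 2\<close>, which is constant along the fibres, and the shape operator in an
  orthonormal frame consisting of a horizontal and a vertical vector has the rows \<open>(2H, \<tau>)\<close> and \<open>(\<tau>, 0)\<close>.  In a
  conformal parameter adapted to this frame
  \<open>2 (H + \<i> \<tau>) p - (\<kappa> - 4 \<tau>\<^sup>2) A\<^sup>2\<close> is the conformal factor times \<open>H\<^sup>2 + \<kappa> / 4\<close> (\<open>Q_AR_R\<close>).  So the norm of the
  Abresch--Rosenberg differential is at least \<open>\<kappa> / 4 > 0\<close> everywhere, while \<open>|dH|\<close> is bounded on a compact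
  surface; a multiple of the one dominates the other, although \<open>H\<close> is not constant.

  The torus is uniformised explicitly.  A unit-speed horizontal lift \<open>\<zeta>\<close> of the base curve satisfies
  \<open>\<zeta>'' = - \<zeta> + 2 q i \<zeta>'\<close> with \<open>q\<close> proportional to the geodesic curvature, and \<open>R (x + i y) = e\<^sup>i\<^sup>c\<^sup>y \<zeta>(x)\<close> is a
  conformal immersion of the plane with constant conformal factor \<open>4 / \<kappa>\<close> for a suitable constant \<open>c\<close>
  (\<open>patch_metric_R\<close>, \<open>S_R\<close>).  It factors through a covering \<open>P\<close> of the product of two circles whose deck
  group consists of translations, and restrictions of \<open>P\<close> form the atlas.  An arbitrary positively oriented
  conformal parameter differs from a sheet of \<open>P\<close> by a holomorphic map, under which both norms are
  invariant (\<open>oriented_similarity_is_mult\<close>, \<open>Q_AR_change\<close>, \<open>AR_bound_in_conformal_param\<close>).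

  A closed curve with an explicit arc length parameter is found by prescribing its direction angle and its
  distance from a pole, which leaves the longitude to an integral that vanishes over a period by symmetry
  (\<open>horizontal_curve_exists\<close>).

  Since the torus is compact it is complete (\<open>complete_surface_\<psi>\<close>), and so it also refutes the general
  assertion about complete surfaces.
\<close>

section \<open>A calculus of smooth maps\<close>

text \<open>
  The closure of \<open>Ck_on\<close> under the usual operations is an induction on the order.  On the whole
  space a derivative given by a formula is equal, as a function, to the one in the definition of \<open>Ck_on\<close>, so it
  can be substituted there.
\<close>

lemma Ck_on_SucI:
  assumes "\<And>x. (f has_derivative f' x) (at x)"
    and "\<And>v. Ck_on n (\<lambda>x. f' x v) UNIV"
  shows "Ck_on (Suc n) f UNIV"
proof -
  have "frechet_derivative f (at x) = f' x" for x
    using frechet_derivative_at[OF assms(1)] by simp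
  then show ?thesis using assms by (auto simp: differentiable_def)
qed

lemma Ck_on_imp_continuous_on: "Ck_on n f U \<Longrightarrow> continuous_on U f"
  by (cases n) (auto intro!: differentiable_imp_continuous_on differentiable_at_imp_differentiable_on)

lemma Ck_on_Suc_imp: "Ck_on (Suc n) f U \<Longrightarrow> Ck_on n f U"
proof (induction n arbitrary: f)
  case 0
  then show ?case using Ck_on_imp_continuous_on by (simp only: Ck_on.simps(1))
next
  case (Suc n)
  from Suc.prems[unfolded Ck_on.simps(2)[of "Suc n" f U]] have 1: "\<forall>x\<in>U. f differentiable (at x)"
    and 2: "\<And>v. Ck_on (Suc n) (\<lambda>x. frechet_derivative f (at x) v) U"
    by blast+
  show ?case unfolding Ck_on.simps(2)[of n f U] using 1 Suc.IH[OF 2] by blast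
qed

lemma Ck_on_SucE:
  assumes "Ck_on (Suc n) f UNIV"
  obtains f' where "\<And>x. (f has_derivative f' x) (at x)" "\<And>v. Ck_on n (\<lambda>x. f' x v) UNIV"
  using assms frechet_derivative_works by (metis Ck_on.simps(2) UNIV_I)

lemma Ck_on_subset: "Ck_on n f V \<Longrightarrow> U \<subseteq> V \<Longrightarrow> Ck_on n f U"
  by (induction n arbitrary: f) (auto intro: continuous_on_subset)

lemma Ck_on_const: "Ck_on n (\<lambda>x. c) UNIV"
proof (induction n arbitrary: c)
  case (Suc n)
  show ?case by (rule Ck_on_SucI[where f' = "\<lambda>x v. 0"]) (auto intro: Suc)
qed simp

lemma Ck_on_bounded_linear_compose:
  assumes "bounded_linear L" "Ck_on n f UNIV"
  shows "Ck_on n (\<lambda>x. L (f x)) UNIV"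
  using assms(2)
proof (induction n arbitrary: f)
  case 0
  then show ?case by (simp add: bounded_linear.continuous_on[OF assms(1)])
next
  case (Suc n)
  from Suc.prems obtain f' where f: "\<And>x. (f has_derivative f' x) (at x)" "\<And>v. Ck_on n (\<lambda>x. f' x v) UNIV"
    by (rule Ck_on_SucE) blast
  show ?case
    by (rule Ck_on_SucI[where f' = "\<lambda>x v. L (f' x v)"])
      (auto intro: bounded_linear.has_derivative[OF assms(1)] f Suc.IH)
qed

lemma Ck_on_add:
  assumes "Ck_on n f UNIV" "Ck_on n g UNIV"
  shows "Ck_on n (\<lambda>x. f x + g x) UNIV"
  using assms
proof (induction n arbitrary: f g)
  case 0
  then show ?case by (simp add: continuous_on_add)
next
  case (Suc n)
  from Suc.prems(1) obtain f' where f: "\<And>x. (f has_derivative f' x) (at x)" "\<And>v. Ck_on n (\<lambda>x. f' x v) UNIV"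
    by (rule Ck_on_SucE) blast
  from Suc.prems(2) obtain g' where g: "\<And>x. (g has_derivative g' x) (at x)" "\<And>v. Ck_on n (\<lambda>x. g' x v) UNIV"
    by (rule Ck_on_SucE) blast
  show ?case
    by (rule Ck_on_SucI[where f' = "\<lambda>x v. f' x v + g' x v"]) (auto intro: f g Suc.IH has_derivative_add)
qed

lemma Ck_on_Pair:
  assumes "Ck_on n f UNIV" "Ck_on n g UNIV"
  shows "Ck_on n (\<lambda>x. (f x, g x)) UNIV"
  using assms
proof (induction n arbitrary: f g)
  case 0
  then show ?case by (simp add: continuous_on_Pair)
next
  case (Suc n)
  from Suc.prems(1) obtain f' where f: "\<And>x. (f has_derivative f' x) (at x)" "\<And>v. Ck_on n (\<lambda>x. f' x v) UNIV"
    by (rule Ck_on_SucE) blast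
  from Suc.prems(2) obtain g' where g: "\<And>x. (g has_derivative g' x) (at x)" "\<And>v. Ck_on n (\<lambda>x. g' x v) UNIV"
    by (rule Ck_on_SucE) blast
  show ?case
    by (rule Ck_on_SucI[where f' = "\<lambda>x v. (f' x v, g' x v)"]) (auto intro: f g Suc.IH has_derivative_Pair)
qed

lemma Ck_on_mult:
  fixes f g :: "'a::real_normed_vector \<Rightarrow> 'b::real_normed_algebra"
  assumes "Ck_on n f UNIV" "Ck_on n g UNIV"
  shows "Ck_on n (\<lambda>x. f x * g x) UNIV"
  using assms
proof (induction n arbitrary: f g)
  case 0
  then show ?case by (simp add: continuous_on_mult)
next
  case (Suc n)
  from Suc.prems(1) obtain f' where f: "\<And>x. (f has_derivative f' x) (at x)" "\<And>v. Ck_on n (\<lambda>x. f' x v) UNIV"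
    by (rule Ck_on_SucE) blast
  from Suc.prems(2) obtain g' where g: "\<And>x. (g has_derivative g' x) (at x)" "\<And>v. Ck_on n (\<lambda>x. g' x v) UNIV"
    by (rule Ck_on_SucE) blast
  note fg = Ck_on_Suc_imp[OF Suc.prems(1)] Ck_on_Suc_imp[OF Suc.prems(2)]
  show ?case
    by (rule Ck_on_SucI[where f' = "\<lambda>x v. f x * g' x v + f' x v * g x"])
      (intro f g fg Suc.IH has_derivative_mult Ck_on_add)+
qed

lemma Ck_on_inverse:
  fixes f :: "'a::real_normed_vector \<Rightarrow> 'b::real_normed_field"
  assumes "Ck_on n f UNIV" "\<And>x. f x \<noteq> 0"
  shows "Ck_on n (\<lambda>x. inverse (f x)) UNIV"
  using assms
proof (induction n)
  case 0
  then show ?case by (simp add: continuous_on_inverse)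
next
  case (Suc n)
  from Suc.prems(1) obtain f' where f: "\<And>x. (f has_derivative f' x) (at x)" "\<And>v. Ck_on n (\<lambda>x. f' x v) UNIV"
    by (rule Ck_on_SucE) blast
  have I: "Ck_on n (\<lambda>x. inverse (f x)) UNIV" by (rule Suc.IH[OF Ck_on_Suc_imp]) (use Suc.prems in auto)
  show ?case
    by (rule Ck_on_SucI[where f' = "\<lambda>x v. - (inverse (f x) * f' x v * inverse (f x))"])
      (intro Deriv.has_derivative_inverse f Suc.prems Ck_on_mult I
        Ck_on_bounded_linear_compose[OF bounded_linear_minus[OF bounded_linear_ident]])+
qed

lemma Ck_on_exp:
  fixes f :: "'a::real_normed_vector \<Rightarrow> complex"
  assumes "Ck_on n f UNIV"
  shows "Ck_on n (\<lambda>x. exp (f x)) UNIV"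
  using assms
proof (induction n)
  case 0
  then show ?case by (simp add: continuous_on_exp)
next
  case (Suc n)
  from Suc.prems(1) obtain f' where f: "\<And>x. (f has_derivative f' x) (at x)" "\<And>v. Ck_on n (\<lambda>x. f' x v) UNIV"
    by (rule Ck_on_SucE) blast
  have I: "Ck_on n (\<lambda>x. exp (f x)) UNIV" by (rule Suc.IH[OF Ck_on_Suc_imp]) (use Suc.prems in auto)
  have D: "((\<lambda>x. exp (f x)) has_derivative (\<lambda>v. f' x v * exp (f x))) (at x)" for x
    using has_derivative_compose[OF f(1), of exp "(*) (exp (f x))" x] DERIV_exp[of "f x"]
    by (simp add: has_field_derivative_def mult.commute)
  show ?case
    by (rule Ck_on_SucI[OF D]) (intro Ck_on_mult f I)
qed

text \<open>
  The curve below has phases that are antiderivatives without closed form; smoothness passes from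
  the explicit derivative to them.
\<close>

lemma Ck_on_of_real_antiderivative:
  fixes f :: "real \<Rightarrow> real"
  assumes "\<And>x. (f has_real_derivative f' x) (at x)" "Ck_on n (\<lambda>x. complex_of_real (f' x)) UNIV"
  shows "Ck_on (Suc n) (\<lambda>x. complex_of_real (f x)) UNIV"
proof (rule Ck_on_SucI)
  show "((\<lambda>x. complex_of_real (f x)) has_derivative (\<lambda>v. complex_of_real (f' x) * complex_of_real v)) (at x)" for x
    using bounded_linear.has_derivative[OF bounded_linear_of_real assms(1)[of x, unfolded has_field_derivative_def]]
    by simp
  show "Ck_on n (\<lambda>x. complex_of_real (f' x) * complex_of_real v) UNIV" for v
    by (intro Ck_on_mult assms Ck_on_const)
qed

lemma Ck_on_of_real_cos_sin:
  fixes f :: "real \<Rightarrow> real"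
  assumes "Ck_on n (\<lambda>x. complex_of_real (f x)) UNIV"
  shows "Ck_on n (\<lambda>x. complex_of_real (cos (f x))) UNIV" "Ck_on n (\<lambda>x. complex_of_real (sin (f x))) UNIV"
proof -
  have "complex_of_real (cos t) = (exp (\<i> * of_real t) + exp ((- \<i>) * of_real t)) * (1/2)"
    "complex_of_real (sin t) = (exp (\<i> * of_real t) + (- 1) * exp ((- \<i>) * of_real t)) * (1/(2*\<i>))" for t
    by (simp_all add: cos_of_real[symmetric] sin_of_real[symmetric] cos_exp_eq sin_exp_eq)
  moreover have "Ck_on n (\<lambda>x. (exp (\<i> * of_real (f x)) + exp ((- \<i>) * of_real (f x))) * (1/2)) UNIV"
    "Ck_on n (\<lambda>x. (exp (\<i> * of_real (f x)) + (- 1) * exp ((- \<i>) * of_real (f x))) * (1/(2*\<i>))) UNIV"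
    by (intro Ck_on_mult Ck_on_add Ck_on_exp Ck_on_const assms)+
  ultimately show "Ck_on n (\<lambda>x. complex_of_real (cos (f x))) UNIV" "Ck_on n (\<lambda>x. complex_of_real (sin (f x))) UNIV"
    by (simp_all only:)
qed

text \<open>
  The transition maps between sheets of a flat torus are translations near each point, with a
  translation vector that may change from one component of the domain to another.
\<close>

lemma locally_translation_smooth:
  fixes \<phi> :: "complex \<Rightarrow> complex"
  assumes "open W" "\<And>z. z \<in> W \<Longrightarrow> \<exists>a. \<forall>\<^sub>F w in nhds z. \<phi> w = w + a"
  shows "smooth_on \<phi> W" "\<And>z. z \<in> W \<Longrightarrow> frechet_derivative \<phi> (at z) = (\<lambda>v. v)"
proof -
  have D: "(\<phi> has_derivative (\<lambda>v. v)) (at z)" if "z \<in> W" for z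
  proof -
    obtain a where a: "\<forall>\<^sub>F w in nhds z. w + a = \<phi> w" using assms(2)[OF \<open>z \<in> W\<close>] by (metis (mono_tags, lifting) eventually_mono)
    have "((\<lambda>w. w + a) has_derivative (\<lambda>v. v)) (at z)"
      by (auto intro!: derivative_eq_intros)
    then show ?thesis
      by (rule has_derivative_transform_eventually)
        (use a in \<open>auto simp: eventually_nhds_conv_at\<close>)
  qed
  then show fd: "\<And>z. z \<in> W \<Longrightarrow> frechet_derivative \<phi> (at z) = (\<lambda>v. v)"
    using frechet_derivative_at by metis
  have const: "Ck_on n g W" if "\<And>z. z \<in> W \<Longrightarrow> g z = c" for g :: "complex \<Rightarrow> complex" and c n
    using that
  proof (induction n arbitrary: g c)
    case 0
    then show ?case by (simp cong: continuous_on_cong)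
  next
    case (Suc n)
    have "(g has_derivative (\<lambda>v. 0)) (at z)" if "z \<in> W" for z
      by (rule has_derivative_transform_within_open[OF has_derivative_const[of c] \<open>open W\<close> that]) (use Suc in simp)
    then have "\<And>z. z \<in> W \<Longrightarrow> g differentiable at z" "\<And>z. z \<in> W \<Longrightarrow> frechet_derivative g (at z) = (\<lambda>v. 0)"
      using frechet_derivative_at by (force simp: differentiable_def, metis)
    then show ?case by (auto intro!: Suc.IH[of _ 0])
  qed
  have "continuous_on W \<phi>" by (meson D continuous_at_imp_continuous_on has_derivative_continuous)
  moreover have "Ck_on (Suc n) \<phi> W" for n
    using D by (auto simp: differentiable_def intro!: const fun_cong[OF fd])
  ultimately have "Ck_on n \<phi> W" for n by (cases n) auto
  then show "smooth_on \<phi> W" by (simp add: smooth_on_def)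
qed


section \<open>Conformal changes of the parameter\<close>

lemma berger_metric_simps:
  "berger_metric \<kappa> \<tau> p (X + Y) Z = berger_metric \<kappa> \<tau> p X Z + berger_metric \<kappa> \<tau> p Y Z"
  "berger_metric \<kappa> \<tau> p Z (X + Y) = berger_metric \<kappa> \<tau> p Z X + berger_metric \<kappa> \<tau> p Z Y"
  "berger_metric \<kappa> \<tau> p (a *\<^sub>R X) Z = a * berger_metric \<kappa> \<tau> p X Z"
  "berger_metric \<kappa> \<tau> p Z (a *\<^sub>R X) = a * berger_metric \<kappa> \<tau> p Z X"
  by (simp_all add: berger_metric_def inner_simps algebra_simps add_divide_distrib diff_divide_distrib)

text \<open>
  The cross product is bilinear and alternating, so a change of basis multiplies it by the
  determinant; the unit normal therefore depends only on the oriented plane.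
\<close>

lemma berger_cross_change_of_basis:
  "berger_cross \<kappa> \<tau> p (a *\<^sub>R X + b *\<^sub>R Y) (c *\<^sub>R X + d *\<^sub>R Y) = (a * d - b * c) *\<^sub>R berger_cross \<kappa> \<tau> p X Y"
  by (simp add: berger_cross_def Let_def berger_metric_simps scaleR_add_right)
    (simp add: algebra_simps flip: scaleR_left_distrib scaleR_left_diff_distrib)

lemma berger_normal_change_of_basis:
  assumes "a * d - b * c > 0"
  shows "berger_normal \<kappa> \<tau> p (a *\<^sub>R X + b *\<^sub>R Y) (c *\<^sub>R X + d *\<^sub>R Y) = berger_normal \<kappa> \<tau> p X Y"
  using assms unfolding berger_normal_def berger_cross_change_of_basis
  by (simp add: Let_def berger_metric_simps real_sqrt_mult flip: power2_eq_square mult.assoc)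

lemma endo_trace_complex: "endo_trace (L :: complex \<Rightarrow> complex) = Re (L 1) + Im (L \<i>)"
  by (simp add: endo_trace_def Basis_complex_def inner_complex_def)

lemma real_linear_complex:
  assumes "linear (L :: complex \<Rightarrow> 'a::real_vector)"
  shows "L v = Re v *\<^sub>R L 1 + Im v *\<^sub>R L \<i>"
proof -
  have "v = Re v *\<^sub>R 1 + Im v *\<^sub>R \<i>" by (simp add: complex_eq_iff)
  then have "L v = L (Re v *\<^sub>R 1 + Im v *\<^sub>R \<i>)" by (rule arg_cong)
  then show ?thesis using assms by (simp only: linear_add linear_scale)
qed

text \<open>An orientation-preserving similarity of the plane is a complex multiplication, so changes
  between conformal parameters of the same orientation are holomorphic.\<close>

lemma oriented_similarity_is_mult:
  assumes L: "linear (L :: complex \<Rightarrow> complex)" and sim: "\<And>v w. L v \<bullet> L w = l * (v \<bullet> w)"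
    and or: "Im (cnj (L 1) * L \<i>) > 0"
  shows "L v = L 1 * v" "L 1 \<noteq> 0"
proof -
  define a b where "a = L 1" and "b = L \<i>"
  have 1: "a \<bullet> b = 0" "a \<bullet> a = b \<bullet> b" using sim[of 1 \<i>] sim[of 1 1] sim[of \<i> \<i>]
    by (simp_all add: a_def b_def inner_complex_def)
  have pos: "Re a * Im b - Im a * Re b > 0" using or by (simp add: a_def b_def)
  have dot: "Re a * Re b + Im a * Im b = 0" and nrm: "Re b * Re b + Im b * Im b = Re a * Re a + Im a * Im a"
    using 1 by (simp_all add: inner_complex_def)
  have "(Re a * Im b - Im a * Re b)\<^sup>2 + (Re a * Re b + Im a * Im b)\<^sup>2
      = (Re a * Re a + Im a * Im a) * (Re b * Re b + Im b * Im b)"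
    by (simp add: power2_eq_square algebra_simps)
  then have "(Re a * Im b - Im a * Re b)\<^sup>2 = (Re a * Re a + Im a * Im a)\<^sup>2"
    unfolding dot nrm by (simp only: power2_eq_square mult_zero_left add_0_right)
  then have eq: "Re a * Im b - Im a * Re b = Re a * Re a + Im a * Im a"
    by (rule power2_eq_imp_eq) (use pos in auto)
  have "(Re b + Im a)\<^sup>2 + (Im b - Re a)\<^sup>2
      = (b \<bullet> b - a \<bullet> a) + 2 * ((Re a * Re a + Im a * Im a) - (Re a * Im b - Im a * Re b))"
    by (simp add: inner_complex_def power2_eq_square algebra_simps)
  then have "(Re b + Im a)\<^sup>2 + (Im b - Re a)\<^sup>2 = 0" using eq 1 by simp
  then have "b = \<i> * a" by (simp add: sum_power2_eq_zero_iff complex_eq_iff)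
  then show "L v = L 1 * v"
    by (simp add: real_linear_complex[OF L, of v] a_def b_def complex_eq_iff algebra_simps)
  show "L 1 \<noteq> 0" using or by auto
qed

lemma shape_operator_eqI:
  assumes "inj (patch_d r z)"
    and "patch_d r z w = - berger_nabla \<kappa> \<tau> r (patch_normal \<kappa> \<tau> r) z v"
  shows "shape_operator \<kappa> \<tau> r z v = w"
  unfolding shape_operator_def using assms by (metis (mono_tags, lifting) inj_eq the_equality)

text \<open>
  Here \<open>g = r \<circ> \<phi>\<close> near the points of \<open>W\<close>, where \<open>\<phi>\<close> is holomorphic with derivative \<open>\<mu>\<close>; the map \<open>S w\<close>
  is the shape operator of \<open>r\<close> at \<open>w\<close>, given by the equation that determines it.
\<close>

locale conformal_change =
  fixes \<kappa> \<tau> :: real and r g :: "complex \<Rightarrow> C2" and \<phi> \<mu> :: "complex \<Rightarrow> complex" and W :: "complex set"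
    and S :: "complex \<Rightarrow> complex \<Rightarrow> complex"
  assumes W: "open W" and \<phi>: "\<And>z. z \<in> W \<Longrightarrow> (\<phi> has_derivative (*) (\<mu> z)) (at z)"
    and \<mu>: "\<And>z. z \<in> W \<Longrightarrow> \<mu> z \<noteq> 0"
    and g: "\<And>z. z \<in> W \<Longrightarrow> g z = r (\<phi> z)"
    and r: "\<And>w. r differentiable (at w)"
    and N: "\<And>w. patch_normal \<kappa> \<tau> r differentiable (at w)"
    and inj: "\<And>w. inj (patch_d r w)"
    and S: "\<And>w v. patch_d r w (S w v) = - berger_nabla \<kappa> \<tau> r (patch_normal \<kappa> \<tau> r) w v"
    and lin: "\<And>w. linear (S w)"
begin

lemma frechet_chain:
  assumes z: "z \<in> W" and f: "f differentiable (at (\<phi> z))" and h: "\<And>z. z \<in> W \<Longrightarrow> h z = f (\<phi> z)"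
  shows "frechet_derivative h (at z) v = frechet_derivative f (at (\<phi> z)) (\<mu> z * v)"
proof -
  have "(f has_derivative frechet_derivative f (at (\<phi> z))) (at (\<phi> z))"
    using f by (simp add: frechet_derivative_works)
  from has_derivative_compose[OF \<phi>[OF z] this]
  have "((\<lambda>z. f (\<phi> z)) has_derivative (\<lambda>v. frechet_derivative f (at (\<phi> z)) (\<mu> z * v))) (at z)" .
  then have "(h has_derivative (\<lambda>v. frechet_derivative f (at (\<phi> z)) (\<mu> z * v))) (at z)"
    by (rule has_derivative_transform_within_open[OF _ W z]) (simp add: h)
  then show ?thesis using frechet_derivative_at by metis
qed

lemma patch_d_change: "z \<in> W \<Longrightarrow> patch_d g z v = patch_d r (\<phi> z) (\<mu> z * v)"
  unfolding patch_d_def by (rule frechet_chain) (auto simp: r g)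

lemma linear_patch_d: "linear (patch_d r w)"
  unfolding patch_d_def[abs_def] using r by (rule linear_frechet_derivative)

lemma patch_normal_change:
  assumes "z \<in> W"
  shows "patch_normal \<kappa> \<tau> g z = patch_normal \<kappa> \<tau> r (\<phi> z)"
proof -
  have "Re (\<mu> z) * Re (\<mu> z) - Im (\<mu> z) * (- Im (\<mu> z)) > 0"
    using \<mu>[OF assms] by (simp add: complex_eq_iff sum_squares_gt_zero_iff)
  note pos = berger_normal_change_of_basis[OF this]
  show ?thesis
    unfolding patch_normal_def patch_d_change[OF assms] g[OF assms]
      real_linear_complex[OF linear_patch_d, of "\<phi> z" "\<mu> z * 1"]
      real_linear_complex[OF linear_patch_d, of "\<phi> z" "\<mu> z * \<i>"]
    using pos[of \<kappa> \<tau> "r (\<phi> z)" "patch_d r (\<phi> z) 1" "patch_d r (\<phi> z) \<i>"] by simp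
qed

lemma shape_operator_base: "shape_operator \<kappa> \<tau> r w v = S w v"
  by (rule shape_operator_eqI[OF inj S])

lemma shape_operator_change:
  assumes z: "z \<in> W"
  shows "shape_operator \<kappa> \<tau> g z v = S (\<phi> z) (\<mu> z * v) / \<mu> z"
proof (rule shape_operator_eqI)
  show "inj (patch_d g z)"
    unfolding inj_def using inj_eq[OF inj[of "\<phi> z"]] \<mu>[OF z] by (simp add: patch_d_change[OF z])
  have "frechet_derivative (patch_normal \<kappa> \<tau> g) (at z) v
      = frechet_derivative (patch_normal \<kappa> \<tau> r) (at (\<phi> z)) (\<mu> z * v)"
    by (rule frechet_chain[OF z N patch_normal_change])
  then have "berger_nabla \<kappa> \<tau> g (patch_normal \<kappa> \<tau> g) z v
      = berger_nabla \<kappa> \<tau> r (patch_normal \<kappa> \<tau> r) (\<phi> z) (\<mu> z * v)"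
    using patch_d_change[OF z] by (simp add: berger_nabla_def patch_normal_change[OF z] g[OF z] patch_d_def)
  then show "patch_d g z (S (\<phi> z) (\<mu> z * v) / \<mu> z) = - berger_nabla \<kappa> \<tau> g (patch_normal \<kappa> \<tau> g) z v"
    using S[of "\<phi> z" "\<mu> z * v"] \<mu>[OF z] by (simp add: patch_d_change[OF z])
qed

lemma mean_curvature_change:
  assumes z: "z \<in> W"
  shows "mean_curvature \<kappa> \<tau> g z = mean_curvature \<kappa> \<tau> r (\<phi> z)"
proof -
  define m where "m = \<mu> z"
  have m: "cmod m \<noteq> 0" using \<mu>[OF z] by (simp add: m_def)
  note L = real_linear_complex[OF lin[of "\<phi> z"]]
  have "Re (S (\<phi> z) m * cnj m) + Im (S (\<phi> z) (m * \<i>) * cnj m) = (Re (S (\<phi> z) 1) + Im (S (\<phi> z) \<i>)) * (cmod m)\<^sup>2"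
    unfolding L[of m] L[of "m * \<i>"] cmod_power2 by (simp add: power2_eq_square algebra_simps)
  then have "Re (S (\<phi> z) m / m) + Im (S (\<phi> z) (m * \<i>) / m) = Re (S (\<phi> z) 1) + Im (S (\<phi> z) \<i>)"
    using m unfolding complex_div_cnj[of _ m] by (simp add: Re_divide_of_real Im_divide_of_real flip: add_divide_distrib of_real_power)
  then show ?thesis
    by (simp add: mean_curvature_def endo_trace_complex shape_operator_change[OF z] shape_operator_base m_def)
qed

text \<open>
  The Abresch--Rosenberg differential is a quadratic differential: the coefficient of the second
  fundamental form is a quadratic form in \<open>\<partial>\<^sub>\<zeta>\<close> and the height form is linear in it, whereas
  \<open>\<partial>\<^sub>\<zeta>\<close> is multiplied by \<open>\<mu>\<close>.
\<close>

lemma Q_AR_change: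
  assumes z: "z \<in> W"
  shows "Q_AR \<kappa> \<tau> g z = (\<mu> z)\<^sup>2 * Q_AR \<kappa> \<tau> r (\<phi> z)"
proof -
  define m where "m = \<mu> z"
  have m: "m \<noteq> 0" using \<mu>[OF z] by (simp add: m_def)
  define B where "B v w = patch_metric \<kappa> \<tau> r (\<phi> z) (S (\<phi> z) v) w" for v w
  define C where "C v = berger_metric \<kappa> \<tau> (r (\<phi> z)) (berger_xi \<kappa> \<tau> (r (\<phi> z))) (patch_d r (\<phi> z) v)" for v
  have B1: "linear (\<lambda>v. B v w)" and B2: "linear (B v)" and C: "linear C" for v w
    unfolding B_def C_def patch_metric_def
    by (rule linearI; simp add: linear_add[OF linear_patch_d] linear_add[OF lin] linear_scale[OF linear_patch_d]
      linear_scale[OF lin] berger_metric_simps)+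
  have B: "B v w = Re v * Re w * B 1 1 + Re v * Im w * B 1 \<i> + Im v * Re w * B \<i> 1 + Im v * Im w * B \<i> \<i>" for v w
    unfolding real_linear_complex[OF B2, of v w] real_linear_complex[OF B1, of v 1] real_linear_complex[OF B1, of v \<i>]
    by (simp add: algebra_simps)
  have CC: "C v = Re v * C 1 + Im v * C \<i>" for v
    unfolding real_linear_complex[OF C, of v] by simp
  have p: "complexify_form (patch_metric \<kappa> \<tau> g z)
       (complexify_map (shape_operator \<kappa> \<tau> g z) d_zeta) d_zeta
     = Complex (B (m / 2) (m / 2) - B (m * (- \<i> / 2)) (m * (- \<i> / 2)))
        (B (m / 2) (m * (- \<i> / 2)) + B (m * (- \<i> / 2)) (m / 2))"
    using m by (simp add: complexify_form_def complexify_map_def d_zeta_def patch_metric_def patch_d_change[OF z]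
        g[OF z] shape_operator_change[OF z] B_def m_def)
  have p': "complexify_form (patch_metric \<kappa> \<tau> r (\<phi> z))
       (complexify_map (shape_operator \<kappa> \<tau> r (\<phi> z)) d_zeta) d_zeta
     = Complex (B (1 / 2) (1 / 2) - B (- \<i> / 2) (- \<i> / 2)) (B (1 / 2) (- \<i> / 2) + B (- \<i> / 2) (1 / 2))"
    by (simp add: complexify_form_def complexify_map_def d_zeta_def shape_operator_base B_def)
  have P: "complexify_form (patch_metric \<kappa> \<tau> g z)
       (complexify_map (shape_operator \<kappa> \<tau> g z) d_zeta) d_zeta
     = m\<^sup>2 * complexify_form (patch_metric \<kappa> \<tau> r (\<phi> z))
       (complexify_map (shape_operator \<kappa> \<tau> r (\<phi> z)) d_zeta) d_zeta"
    unfolding p p' B[of "m / 2"] B[of "m * (- \<i> / 2)"] B[of "1 / 2"] B[of "- \<i> / 2"]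
    by (simp add: complex_eq_iff power2_eq_square algebra_simps)
  have A: "complexify_form (berger_metric \<kappa> \<tau> (g z)) (berger_xi \<kappa> \<tau> (g z), 0) (complexify_map (patch_d g z) d_zeta)
     = Complex (C (m / 2)) (C (m * (- \<i> / 2)))"
    by (simp add: complexify_form_def complexify_map_def d_zeta_def patch_d_change[OF z] g[OF z] C_def m_def
        berger_metric_def)
  have A': "complexify_form (berger_metric \<kappa> \<tau> (r (\<phi> z))) (berger_xi \<kappa> \<tau> (r (\<phi> z)), 0)
       (complexify_map (patch_d r (\<phi> z)) d_zeta)
     = Complex (C (1 / 2)) (C (- \<i> / 2))"
    by (simp add: complexify_form_def complexify_map_def d_zeta_def C_def berger_metric_def)
  have AA: "complexify_form (berger_metric \<kappa> \<tau> (g z)) (berger_xi \<kappa> \<tau> (g z), 0) (complexify_map (patch_d g z) d_zeta)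
     = m * complexify_form (berger_metric \<kappa> \<tau> (r (\<phi> z))) (berger_xi \<kappa> \<tau> (r (\<phi> z)), 0)
       (complexify_map (patch_d r (\<phi> z)) d_zeta)"
    unfolding A A' CC[of "m / 2"] CC[of "m * (- \<i> / 2)"] CC[of "1 / 2"] CC[of "- \<i> / 2"]
    by (simp add: complex_eq_iff algebra_simps)
  show ?thesis
    unfolding Q_AR_def Let_def P AA mean_curvature_change[OF z]
    by (simp add: m_def algebra_simps power2_eq_square)
qed

end


section \<open>The Hopf cylinder over a horizontal curve\<close>

text \<open>The flow of the Hopf fibration, by isometries of every Berger metric.\<close>

definition rot :: "real \<Rightarrow> C2 \<Rightarrow> C2" where
  "rot t p = (cis t * fst p, cis t * snd p)"

lemma rot_simps [simp]:
  "rot t (p + p') = rot t p + rot t p'" "rot t (p - p') = rot t p - rot t p'"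
  "rot t (a *\<^sub>R p) = a *\<^sub>R rot t p" "times_i (rot t p) = rot t (times_i p)"
  "rot s (rot t p) = rot (s + t) p" "rot 0 p = p"
  by (simp_all add: rot_def times_i_def algebra_simps flip: cis_mult)

lemma rot_inner [simp]: "rot t p \<bullet> rot t p' = p \<bullet> p'"
proof -
  have c: "(cis t * z) \<bullet> (cis t * w) = z \<bullet> w" for z w
  proof -
    have "(cis t * z) \<bullet> (cis t * w) = ((cos t)\<^sup>2 + (sin t)\<^sup>2) * (z \<bullet> w)"
      by (simp add: inner_complex_def power2_eq_square algebra_simps del: sin_cos_squared_add3)
    then show ?thesis by simp
  qed
  show ?thesis by (simp add: rot_def inner_prod_def c)
qed

lemma rot_has_derivative:
  assumes "(f has_vector_derivative f') (at (Re z))"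
  shows "((\<lambda>z. rot (c * Im z) (f (Re z))) has_derivative
    (\<lambda>v. Re v *\<^sub>R rot (c * Im z) f' + (Im v * c) *\<^sub>R times_i (rot (c * Im z) (f (Re z))))) (at z)"
proof -
  have cis: "((\<lambda>z. cis (c * Im z)) has_derivative (\<lambda>v. (c * Im v) *\<^sub>R (\<i> * cis (c * Im z)))) (at z)"
    by (auto intro!: derivative_eq_intros)
  have f: "((\<lambda>z. f (Re z)) has_derivative (\<lambda>v. Re v *\<^sub>R f')) (at z)"
    using has_derivative_compose[of Re Re z UNIV f] assms
      bounded_linear_imp_has_derivative[OF bounded_linear_Re]
    by (simp add: has_vector_derivative_def)
  show ?thesis
    unfolding rot_def times_i_def
    by (auto intro!: derivative_eq_intros f cis simp: fun_eq_iff algebra_simps)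
qed

text \<open>
  The induction is over all curves \<open>f\<close> at once, since the derivative of such a map in a fixed direction is
  again of this form, with \<open>f\<close> replaced by a combination of \<open>f'\<close> and \<open>times_i f\<close>.
\<close>

lemma Ck_on_rot:
  assumes "Ck_on n f UNIV"
  shows "Ck_on n (\<lambda>z. rot (c * Im z) (f (Re z))) UNIV"
  using assms
proof (induction n arbitrary: f)
  case 0
  then have f: "continuous_on UNIV f" by simp
  have "continuous_on UNIV (\<lambda>z. f (Re z))"
    by (rule continuous_on_compose2[OF f]) (auto intro!: continuous_intros)
  then show ?case
    unfolding rot_def cis_conv_exp by (auto intro!: continuous_intros)
next
  case (Suc n)
  from Suc.prems obtain f' where f: "\<And>x. (f has_derivative f' x) (at x)" "\<And>v. Ck_on n (\<lambda>x. f' x v) UNIV"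
    by (rule Ck_on_SucE) blast
  have lin: "f' x v = v *\<^sub>R f' x 1" for x v
    using linear_scale[OF has_derivative_linear[OF f(1)], of x v 1] by simp
  have D: "(f has_vector_derivative f' x 1) (at x)" for x
    using f(1)[of x] by (simp add: has_vector_derivative_def flip: lin)
  show ?case
  proof (rule Ck_on_SucI[OF rot_has_derivative[OF D]])
    fix v
    have "Ck_on n (\<lambda>x. Re v *\<^sub>R f' x 1 + (Im v * c) *\<^sub>R times_i (f x)) UNIV"
      by (intro Ck_on_add Ck_on_bounded_linear_compose[OF bounded_linear_scaleR_right]
          Ck_on_bounded_linear_compose[OF times_i_linear] f Ck_on_Suc_imp[OF Suc.prems])
    from Suc.IH[OF this]
    show "Ck_on n (\<lambda>z. Re v *\<^sub>R rot (c * Im z) (f' (Re z) 1)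
       + (Im v * c) *\<^sub>R times_i (rot (c * Im z) (f (Re z)))) UNIV"
      by simp
  qed
qed

lemma times_i_eq_xi:
  assumes "\<kappa> > 0" "\<tau> \<noteq> 0"
  shows "times_i p = (4 * \<tau> / \<kappa>) *\<^sub>R berger_xi \<kappa> \<tau> p"
  using assms by (simp add: berger_xi_def)

text \<open>
  Both sides are read off from \<open>\<nabla>\<^sub>X \<xi> = \<tau> X \<times> \<xi>\<close>, the left-hand side of which is computed from the
  explicit connection.
\<close>

lemma berger_cross_vertical:
  assumes "\<kappa> > 0" "\<tau> \<noteq> 0" "p \<in> S3" and X: "X \<bullet> p = 0"
  shows "berger_cross \<kappa> \<tau> p X (times_i p) = (4 * \<tau> / \<kappa>) *\<^sub>R berger_phi p X"
proof -
  have nabla: "\<tau> *\<^sub>R berger_cross \<kappa> \<tau> p X (berger_xi \<kappa> \<tau> p) = \<tau> *\<^sub>R berger_phi p X"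
  proof -
    have pp: "p \<bullet> p = 1" using assms(3) by (simp add: S3_inner)
    have "bounded_linear (berger_xi \<kappa> \<tau>)"
      unfolding berger_xi_def[abs_def]
      by (rule bounded_linear_compose[OF bounded_linear_scaleR_right times_i_linear])
    then have D: "frechet_derivative (berger_xi \<kappa> \<tau>) (at p) = berger_xi \<kappa> \<tau>"
      by (metis bounded_linear_imp_has_derivative frechet_derivative_at)
    have D': "frechet_derivative (\<lambda>x. x) (at p) = (\<lambda>x. x)" by (rule frechet_derivative_ident)
    have "berger_phi p (berger_xi \<kappa> \<tau> p) = 0"
      using pp by (simp add: berger_phi_def berger_xi_def times_i_scaleR)
    then have "berger_nabla \<kappa> \<tau> (\<lambda>x. x) (berger_xi \<kappa> \<tau>) p X
        = berger_xi \<kappa> \<tau> X + (X \<bullet> berger_xi \<kappa> \<tau> p) *\<^sub>R p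
          + ((4 * \<tau>\<^sup>2 / \<kappa> - 1) * (\<kappa> / (4 * \<tau>))) *\<^sub>R berger_phi p X"
      using pp by (simp add: berger_nabla_def D D' berger_Gamma_def berger_xi_def)
    also have "\<dots> = (\<kappa> / (4 * \<tau>) + (4 * \<tau>\<^sup>2 / \<kappa> - 1) * (\<kappa> / (4 * \<tau>))) *\<^sub>R berger_phi p X"
      by (simp add: berger_phi_def berger_xi_def algebra_simps)
    also have "\<kappa> / (4 * \<tau>) + (4 * \<tau>\<^sup>2 / \<kappa> - 1) * (\<kappa> / (4 * \<tau>)) = \<tau>"
      using assms by (simp add: field_simps power2_eq_square)
    finally show ?thesis using berger_nabla_xi[OF assms(1-3) X] by simp
  qed
  have "berger_cross \<kappa> \<tau> p X (times_i p) = (4 * \<tau> / \<kappa>) *\<^sub>R berger_cross \<kappa> \<tau> p X (berger_xi \<kappa> \<tau> p)"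
    using berger_cross_change_of_basis[of \<kappa> \<tau> p 1 X 0 "berger_xi \<kappa> \<tau> p" 0 "4 * \<tau> / \<kappa>"]
    by (simp add: times_i_eq_xi[OF assms(1,2), of p])
  then show ?thesis using nabla assms(2) by simp
qed

lemma berger_normal_hopf:
  assumes "\<kappa> > 0" "\<tau> \<noteq> 0" "p \<in> S3" and X: "X \<bullet> p = 0" "X \<bullet> times_i p = 0" "X \<bullet> X = 1"
  shows "berger_normal \<kappa> \<tau> p X ((sqrt \<kappa> / (2 * \<tau>)) *\<^sub>R times_i p) = (sqrt \<kappa> / 2) *\<^sub>R times_i X"
proof -
  have s: "sqrt \<kappa> * sqrt \<kappa> = \<kappa>" using assms by simp
  have iX: "times_i X \<bullet> times_i p = 0" using X by simp
  have "berger_cross \<kappa> \<tau> p X ((sqrt \<kappa> / (2 * \<tau>)) *\<^sub>R times_i p)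
    = ((sqrt \<kappa> / (2 * \<tau>)) * (4 * \<tau> / \<kappa>)) *\<^sub>R times_i X"
    using berger_cross_change_of_basis[of \<kappa> \<tau> p 1 X 0 "times_i p" 0 "sqrt \<kappa> / (2 * \<tau>)"]
      berger_cross_vertical[OF assms(1-4)] X by (simp add: berger_phi_def)
  also have "(sqrt \<kappa> / (2 * \<tau>)) * (4 * \<tau> / \<kappa>) = 2 / sqrt \<kappa>"
    using assms s by (simp add: field_simps)
  finally have c: "berger_cross \<kappa> \<tau> p X ((sqrt \<kappa> / (2 * \<tau>)) *\<^sub>R times_i p) = (2 / sqrt \<kappa>) *\<^sub>R times_i X" .
  have "berger_metric \<kappa> \<tau> p ((2 / sqrt \<kappa>) *\<^sub>R times_i X) ((2 / sqrt \<kappa>) *\<^sub>R times_i X) = (4 / \<kappa>)\<^sup>2"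
    using X iX assms by (simp add: berger_metric_def power2_eq_square field_simps)
  then have n: "sqrt (berger_metric \<kappa> \<tau> p ((2 / sqrt \<kappa>) *\<^sub>R times_i X) ((2 / sqrt \<kappa>) *\<^sub>R times_i X)) = 4 / \<kappa>"
    using assms(1) by simp
  have "1 / (4 / \<kappa>) * (2 / sqrt \<kappa>) = sqrt \<kappa> / 2"
    using assms(1) s by (simp add: field_simps)
  then show ?thesis
    unfolding berger_normal_def c Let_def n scaleR_scaleR by (rule arg_cong)
qed

text \<open>
  A unit-speed curve in the sphere that is horizontal, i.e. orthogonal to the Hopf fibres; \<open>q\<close> is
  half the geodesic curvature of its projection to the sphere of curvature 4.  The projection closes
  up after the length \<open>L\<close>, the curve itself only up to the holonomy \<open>\<beta> * L\<close>.
\<close>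

locale horizontal_curve =
  fixes \<zeta> \<zeta>' :: "real \<Rightarrow> C2" and q q' :: "real \<Rightarrow> real" and L \<beta> h\<^sub>0 :: real
  assumes L: "L > 0"
    and \<zeta>: "\<And>x. (\<zeta> has_vector_derivative \<zeta>' x) (at x)"
    and \<zeta>': "\<And>x. (\<zeta>' has_vector_derivative (2 * q x) *\<^sub>R times_i (\<zeta>' x) - \<zeta> x) (at x)"
    and frame: "\<And>x. \<zeta> x \<bullet> \<zeta> x = 1" "\<And>x. \<zeta>' x \<bullet> \<zeta>' x = 1" "\<And>x. \<zeta>' x \<bullet> \<zeta> x = 0"
      "\<And>x. \<zeta>' x \<bullet> times_i (\<zeta> x) = 0"
    and smooth: "\<And>n. Ck_on n \<zeta> UNIV"
    and q: "\<And>x. (q has_real_derivative q' x) (at x)" and q'_le: "\<And>x. \<bar>q' x\<bar> \<le> h\<^sub>0"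
    and q_nonconst: "\<exists>x y. q x \<noteq> q y"
    and closing: "\<And>x. \<zeta> (x + L) = rot (\<beta> * L) (\<zeta> x)"

locale hopf_cylinder = horizontal_curve +
  fixes \<kappa> \<tau> :: real
  assumes \<kappa>: "\<kappa> > 0" and \<tau>: "\<tau> \<noteq> 0"
begin

text \<open>The speed \<open>c\<close> along the fibres is the one that makes the patch conformal.\<close>

definition c :: real where "c = sqrt \<kappa> / (2 * \<tau>)"

definition R :: "complex \<Rightarrow> C2" where "R z = rot (c * Im z) (\<zeta> (Re z))"

definition X :: "complex \<Rightarrow> C2" where "X z = rot (c * Im z) (\<zeta>' (Re z))"

lemma c_nonzero: "c \<noteq> 0" using \<kappa> \<tau> by (simp add: c_def)

lemma patch_frame: "R z \<bullet> R z = 1" "X z \<bullet> X z = 1" "X z \<bullet> R z = 0" "X z \<bullet> times_i (R z) = 0"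
  using frame by (simp_all add: R_def X_def)

lemma R_in_S3: "R z \<in> S3"
  using patch_frame(1) by (simp add: norm_eq_1)

lemma R_deriv: "(R has_derivative (\<lambda>v. Re v *\<^sub>R X z + (Im v * c) *\<^sub>R times_i (R z))) (at z)"
  unfolding R_def[abs_def] X_def by (rule rot_has_derivative[OF \<zeta>])

lemma X_deriv: "(X has_derivative (\<lambda>v. Re v *\<^sub>R ((2 * q (Re z)) *\<^sub>R times_i (X z) - R z)
    + (Im v * c) *\<^sub>R times_i (X z))) (at z)"
  using rot_has_derivative[OF \<zeta>'[of "Re z"], of c]
  by (simp add: R_def X_def[abs_def])

lemma patch_d_R: "patch_d R z v = Re v *\<^sub>R X z + (Im v * c) *\<^sub>R times_i (R z)"
  unfolding patch_d_def frechet_derivative_at[OF R_deriv, symmetric] ..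

lemma smooth_R: "Ck_on n R UNIV"
  unfolding R_def[abs_def] by (rule Ck_on_rot[OF smooth])

lemma patch_metric_R: "patch_metric \<kappa> \<tau> R z v w = 4 / \<kappa> * (v \<bullet> w)"
proof -
  have "c * c * (4 * \<tau>\<^sup>2 / \<kappa>) = 1"
    using \<kappa> \<tau> by (simp add: c_def field_simps power2_eq_square)
  moreover have "Im v * c * (Im w * c) * (4 * \<tau>\<^sup>2 / \<kappa>) = Im v * Im w * (c * c * (4 * \<tau>\<^sup>2 / \<kappa>))"
    by (simp only: mult_ac)
  ultimately have vert: "Im v * c * (Im w * c) * (4 * \<tau>\<^sup>2 / \<kappa>) = Im v * Im w" by simp
  have "patch_d R z v \<bullet> patch_d R z w = Re v * Re w + Im v * c * (Im w * c)" "patch_d R z v \<bullet> times_i (R z) = Im v * c" for v w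
    using patch_frame[of z] by (simp_all add: patch_d_R inner_simps inner_commute[of "times_i (R z)" "X z"])
  then have "patch_metric \<kappa> \<tau> R z v w = 4 / \<kappa> * (Re v * Re w + Im v * c * (Im w * c) * (4 * \<tau>\<^sup>2 / \<kappa>))"
    unfolding patch_metric_def berger_metric_def by (simp add: algebra_simps)
  then show ?thesis unfolding vert by (simp add: inner_complex_def)
qed

lemma inj_patch_d_R: "inj (patch_d R z)"
proof (rule injI)
  fix v w assume "patch_d R z v = patch_d R z w"
  moreover have "X z \<bullet> patch_d R z v = Re v" "times_i (R z) \<bullet> patch_d R z v = Im v * c" for v
    using patch_frame[of z] by (simp_all add: patch_d_R inner_simps inner_commute[of "times_i (R z)" "X z"])
  ultimately show "v = w" using c_nonzero by (metis complex_eqI mult_cancel_right)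
qed

lemma patch_normal_R: "patch_normal \<kappa> \<tau> R z = (sqrt \<kappa> / 2) *\<^sub>R times_i (X z)"
  unfolding patch_normal_def patch_d_R
  using berger_normal_hopf[OF \<kappa> \<tau> R_in_S3 patch_frame(3,4,2), of z] by (simp add: c_def)

lemma patch_normal_R_deriv:
  "(patch_normal \<kappa> \<tau> R has_derivative (\<lambda>v. (sqrt \<kappa> / 2) *\<^sub>R times_i
     (Re v *\<^sub>R ((2 * q (Re z)) *\<^sub>R times_i (X z) - R z) + (Im v * c) *\<^sub>R times_i (X z)))) (at z)"
  unfolding patch_normal_R[abs_def]
  by (intro has_derivative_scaleR_right bounded_linear.has_derivative[OF times_i_linear] X_deriv)

text \<open>
  The matrix with rows \<open>(2H, \<tau>)\<close> and \<open>(\<tau>, 0)\<close> in the basis \<open>\<partial>\<^sub>x\<close>, \<open>\<partial>\<^sub>y\<close>.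
\<close>

definition S :: "complex \<Rightarrow> complex \<Rightarrow> complex" where
  "S z v = Complex (sqrt \<kappa> * q (Re z) * Re v + \<tau> * Im v) (\<tau> * Re v)"

lemma linear_S: "linear (S z)"
  by (rule linearI) (simp_all add: S_def complex_eq_iff algebra_simps)

lemma S_R: "patch_d R z (S z v) = - berger_nabla \<kappa> \<tau> R (patch_normal \<kappa> \<tau> R) z v"
proof -
  define b where "b = 4 * \<tau>\<^sup>2 / \<kappa> - 1"
  have s: "sqrt \<kappa> * sqrt \<kappa> = \<kappa>" using \<kappa> by simp
  have c1: "\<tau> * c = sqrt \<kappa> / 2" and c2: "sqrt \<kappa> / 2 * (c * (1 + b)) = \<tau>"
    using \<kappa> \<tau> s by (simp_all add: c_def b_def field_simps power2_eq_square)
  have [simp]: "times_i (R z) \<bullet> X z = 0" "times_i (R z) \<bullet> times_i (R z) = 1"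
    using patch_frame[of z] by (simp_all add: inner_commute)
  have [simp]: "R z \<bullet> X z = 0" "times_i (X z) \<bullet> R z = 0"
    using patch_frame[of z] by (simp_all add: inner_commute[of "R z" "X z"] times_i_skew[of "X z"])
  define A Y where "A = patch_d R z v" and "Y = (sqrt \<kappa> / 2) *\<^sub>R times_i (X z)"
  have in1: "A \<bullet> Y = 0" "Y \<bullet> times_i (R z) = 0" "A \<bullet> times_i (R z) = Im v * c"
    using patch_frame[of z] by (simp_all add: A_def Y_def patch_d_R inner_simps)
  have "berger_phi (R z) Y = (sqrt \<kappa> / 2) *\<^sub>R (- X z)"
    unfolding berger_phi_def in1 by (simp add: Y_def times_i_scaleR)
  then have Gam: "berger_Gamma \<kappa> \<tau> (R z) A Y = (b * (Im v * c) * (sqrt \<kappa> / 2)) *\<^sub>R (- X z)"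
    unfolding berger_Gamma_def in1 b_def[symmetric] by simp
  have "berger_nabla \<kappa> \<tau> R (patch_normal \<kappa> \<tau> R) z v
    = (sqrt \<kappa> / 2) *\<^sub>R times_i
     (Re v *\<^sub>R ((2 * q (Re z)) *\<^sub>R times_i (X z) - R z) + (Im v * c) *\<^sub>R times_i (X z))
     + (b * (Im v * c) * (sqrt \<kappa> / 2)) *\<^sub>R (- X z)"
    unfolding berger_nabla_def frechet_derivative_at[OF patch_normal_R_deriv, symmetric]
      patch_d_def[symmetric] patch_normal_R A_def[symmetric] Y_def[symmetric] Gam ..
  also have "\<dots> = - ((sqrt \<kappa> * q (Re z) * Re v) *\<^sub>R X z + (Im v * (sqrt \<kappa> / 2 * (c * (1 + b)))) *\<^sub>R X z
      + (Re v * (sqrt \<kappa> / 2)) *\<^sub>R times_i (R z))"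
    by (simp add: times_i_scaleR times_i_add linear_diff[OF bounded_linear.linear[OF times_i_linear]] algebra_simps)
  finally have e: "berger_nabla \<kappa> \<tau> R (patch_normal \<kappa> \<tau> R) z v = \<dots>" .
  show ?thesis
    unfolding e c2 by (simp add: patch_d_R S_def c1[symmetric] algebra_simps)
qed

lemma shape_operator_R: "shape_operator \<kappa> \<tau> R z v = S z v"
  by (rule shape_operator_eqI[OF inj_patch_d_R S_R])

lemma mean_curvature_R: "mean_curvature \<kappa> \<tau> R z = sqrt \<kappa> / 2 * q (Re z)"
  by (simp add: mean_curvature_def endo_trace_complex shape_operator_R S_def)

text \<open>
  The fibres are geodesics and the mixed entry of the shape operator is \<open>\<tau>\<close>.  Hence, up to the conformal
  factor, \<open>p = (H - \<i> \<tau>) / 2\<close> and \<open>A\<^sup>2 = - 1 / 4\<close>, and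
  \<open>2 (H + \<i> \<tau>) p - (\<kappa> - 4 \<tau>\<^sup>2) A\<^sup>2 = H\<^sup>2 + \<tau>\<^sup>2 + (\<kappa> - 4 \<tau>\<^sup>2) / 4 = H\<^sup>2 + \<kappa> / 4\<close>: the differential of a Hopf
  cylinder has no zeros.
\<close>

lemma Q_AR_R: "Q_AR \<kappa> \<tau> R z = complex_of_real (4 / \<kappa> * ((mean_curvature \<kappa> \<tau> R z)\<^sup>2 + \<kappa> / 4))"
proof -
  have s: "sqrt \<kappa> * sqrt \<kappa> = \<kappa>" using \<kappa> by simp
  define H where "H = mean_curvature \<kappa> \<tau> R z"
  have q: "sqrt \<kappa> * q (Re z) = 2 * H" by (simp add: H_def mean_curvature_R)
  have p: "complexify_form (patch_metric \<kappa> \<tau> R z)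
                (complexify_map (shape_operator \<kappa> \<tau> R z) d_zeta) d_zeta = 4 / \<kappa> * Complex (H / 2) (- \<tau> / 2)"
    by (simp add: complexify_form_def complexify_map_def d_zeta_def patch_metric_R shape_operator_R S_def
        inner_complex_def q complex_eq_iff)
  have "X z \<bullet> times_i (R z) = 0" "times_i (R z) \<bullet> X z = 0" "times_i (R z) \<bullet> times_i (R z) = 1"
    using patch_frame[of z] by (simp_all add: inner_commute)
  then have A: "complexify_form (berger_metric \<kappa> \<tau> (R z))
                (berger_xi \<kappa> \<tau> (R z), 0) (complexify_map (patch_d R z) d_zeta) = Complex 0 (- 1 / sqrt \<kappa>)"
    using \<kappa> \<tau> by (simp add: complexify_form_def complexify_map_def d_zeta_def patch_d_R berger_metric_def
        berger_xi_def inner_simps c_def field_simps power2_eq_square s complex_eq_iff)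
  have A2: "(Complex 0 (- 1 / sqrt \<kappa>))\<^sup>2 = - (1 / complex_of_real \<kappa>)"
    using \<kappa> s by (simp add: power2_eq_square complex_eq_iff)
  show ?thesis
    unfolding Q_AR_def Let_def p A A2 H_def[symmetric]
    using \<kappa> by (simp add: complex_eq_iff power2_eq_square field_simps)
qed

end


definition torus :: "(complex \<times> complex) set" where
  "torus = sphere 0 1 \<times> sphere 0 1"

lemma cis_eq_1_imp: "cis x = 1 \<Longrightarrow> \<exists>n::int. x = 2 * pi * n"
  using cos_one_2pi_int[of x] by (auto simp: complex_eq_iff mult_ac)

lemma cis_Arg_unit: "cmod z = 1 \<Longrightarrow> cis (Arg z) = z"
  by (subst cis_Arg) (auto simp: sgn_div_norm)

context hopf_cylinder
begin

text \<open>
  In an arbitrary conformal parameter the inequality follows from the one on the cylinder, since both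
  norms are unchanged by a conformal change of the parameter: \<open>|dH| = \<kappa> / 4 * |q'|\<close>, whereas
  \<open>|Q_AR| = H\<^sup>2 + \<kappa> / 4 \<ge> \<kappa> / 4\<close>.
\<close>

lemma AR_bound_in_conformal_param:
  assumes W: "open W" "z \<in> W"
    and \<phi>: "\<And>z. z \<in> W \<Longrightarrow> \<phi> differentiable (at z)"
      "\<And>z. z \<in> W \<Longrightarrow> Im (cnj (frechet_derivative \<phi> (at z) 1) * frechet_derivative \<phi> (at z) \<i>) > 0"
    and g: "\<And>z. z \<in> W \<Longrightarrow> g z = R (\<phi> z)" and conf: "conformal_on \<kappa> \<tau> g W"
  shows "dH_norm \<kappa> \<tau> g z \<le> h\<^sub>0 * AR_norm \<kappa> \<tau> g z"
proof -
  define D where "D z = frechet_derivative \<phi> (at z)" for z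
  define \<mu> where "\<mu> z = D z 1" for z
  have D: "(\<phi> has_derivative D z) (at z)" if "z \<in> W" for z
    using \<phi>(1)[OF that] by (simp add: D_def frechet_derivative_works)
  have dg: "patch_d g z v = patch_d R (\<phi> z) (D z v)" if "z \<in> W" for z v
  proof -
    have "((\<lambda>z. R (\<phi> z)) has_derivative (\<lambda>v. patch_d R (\<phi> z) (D z v))) (at z)"
      using has_derivative_compose[OF D[OF that] R_deriv] by (simp add: patch_d_R)
    then have "(g has_derivative (\<lambda>v. patch_d R (\<phi> z) (D z v))) (at z)"
      by (rule has_derivative_transform_within_open[OF _ W(1) that]) (simp add: g)
    then show ?thesis unfolding patch_d_def[of g] using frechet_derivative_at by metis
  qed
  have mult: "D z v = \<mu> z * v" "\<mu> z \<noteq> 0" if z: "z \<in> W" for z v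
  proof -
    from conf z obtain l where l: "\<And>v w. patch_metric \<kappa> \<tau> g z v w = l * (v \<bullet> w)"
      unfolding conformal_on_def by blast
    have "4 / \<kappa> * (D z v \<bullet> D z w) = l * (v \<bullet> w)" for v w
      unfolding l[symmetric] patch_metric_R[symmetric, of _ _ "\<phi> z"]
      by (simp add: patch_metric_def dg[OF z] g[OF z])
    then have sim: "D z v \<bullet> D z w = (l * \<kappa> / 4) * (v \<bullet> w)" for v w
      using \<kappa> by (simp add: field_simps)
    have lin: "linear (D z)" using D[OF z] by (rule has_derivative_linear)
    have or: "Im (cnj (D z 1) * D z \<i>) > 0" using \<phi>(2)[OF z] by (simp only: D_def)
    show "D z v = \<mu> z * v" "\<mu> z \<noteq> 0"
      unfolding \<mu>_def by (rule oriented_similarity_is_mult[OF lin sim or])+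
  qed
  have D\<mu>: "(\<phi> has_derivative (*) (\<mu> z)) (at z)" if "z \<in> W" for z
  proof -
    have "D z = (*) (\<mu> z)" using mult(1)[OF that] by (rule ext)
    then show ?thesis using D[OF that] by simp
  qed
  interpret ch: conformal_change \<kappa> \<tau> R g \<phi> \<mu> W S
  proof
    show "R differentiable at w" "patch_normal \<kappa> \<tau> R differentiable at w" for w
      using R_deriv patch_normal_R_deriv by (blast intro: differentiableI)+
  qed (fact W(1) D\<mu> mult(2) g inj_patch_d_R S_R linear_add[OF linear_S] linear_scale[OF linear_S])+
  define m where "m = \<mu> z"
  have m: "cmod m > 0" using mult(2)[OF W(2)] by (simp add: m_def)
  have factor: "conformal_factor \<kappa> \<tau> g z = 4 / \<kappa> * (cmod m)\<^sup>2"
  proof -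
    have "conformal_factor \<kappa> \<tau> g z = patch_metric \<kappa> \<tau> R (\<phi> z) m m"
      by (simp add: conformal_factor_def patch_metric_def ch.patch_d_change[OF W(2)] g[OF W(2)] m_def)
    then show ?thesis by (simp add: patch_metric_R dot_square_norm)
  qed
  define H where "H = mean_curvature \<kappa> \<tau> R (\<phi> z)"
  have "AR_norm \<kappa> \<tau> g z = (cmod m)\<^sup>2 * cmod (Q_AR \<kappa> \<tau> R (\<phi> z)) / (4 / \<kappa> * (cmod m)\<^sup>2)"
    unfolding AR_norm_def factor ch.Q_AR_change[OF W(2)] by (simp add: norm_mult norm_power m_def)
  also have "\<dots> = cmod (Q_AR \<kappa> \<tau> R (\<phi> z)) / (4 / \<kappa>)"
    using m by simp
  also have "\<dots> = H\<^sup>2 + \<kappa> / 4"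
  proof -
    have "H\<^sup>2 + \<kappa> / 4 \<ge> 0" using \<kappa> by (intro add_nonneg_nonneg) auto
    then show ?thesis unfolding Q_AR_R norm_of_real H_def[symmetric] abs_mult using \<kappa> by simp
  qed
  finally have AR: "AR_norm \<kappa> \<tau> g z = H\<^sup>2 + \<kappa> / 4" .
  define d where "d v = sqrt \<kappa> / 2 * (q' (Re (\<phi> z)) * Re (m * v))" for v
  have "((\<lambda>z. sqrt \<kappa> / 2 * q (Re (\<phi> z))) has_derivative d) (at z)"
  proof -
    have "((\<lambda>z. Re (\<phi> z)) has_derivative (\<lambda>v. Re (m * v))) (at z)"
      using bounded_linear.has_derivative[OF bounded_linear_Re D\<mu>[OF W(2)]] by (simp add: m_def)
    from has_derivative_compose[OF this q[unfolded has_field_derivative_def]]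
    show ?thesis unfolding d_def by (intro has_derivative_mult_right)
  qed
  then have "(mean_curvature \<kappa> \<tau> g has_derivative d) (at z)"
    by (rule has_derivative_transform_within_open[OF _ W])
      (simp add: ch.mean_curvature_change mean_curvature_R)
  then have "frechet_derivative (mean_curvature \<kappa> \<tau> g) (at z) = d"
    using frechet_derivative_at by metis
  then have "dH_norm \<kappa> \<tau> g z = sqrt (((d 1)\<^sup>2 + (d \<i>)\<^sup>2) / (4 / \<kappa> * (cmod m)\<^sup>2))"
    by (simp add: dH_norm_def factor)
  also have "(d 1)\<^sup>2 + (d \<i>)\<^sup>2 = (sqrt \<kappa> / 2 * q' (Re (\<phi> z)))\<^sup>2 * (cmod m)\<^sup>2"
    unfolding cmod_power2 d_def by (simp add: power2_eq_square algebra_simps)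
  also have "(sqrt \<kappa> / 2 * q' (Re (\<phi> z)))\<^sup>2 * (cmod m)\<^sup>2 / (4 / \<kappa> * (cmod m)\<^sup>2) = (\<kappa> / 4 * q' (Re (\<phi> z)))\<^sup>2"
    using m \<kappa> by (simp add: power_mult_distrib power_divide) (simp add: power2_eq_square)
  finally have "dH_norm \<kappa> \<tau> g z = \<kappa> / 4 * \<bar>q' (Re (\<phi> z))\<bar>"
    using \<kappa> by (simp add: abs_mult)
  also have "\<dots> \<le> \<kappa> / 4 * h\<^sub>0" using q'_le \<kappa> by (intro mult_left_mono) auto
  also have "\<dots> \<le> (H\<^sup>2 + \<kappa> / 4) * h\<^sub>0"
    using order_trans[OF abs_ge_zero q'_le] by (intro mult_right_mono) auto
  finally show ?thesis by (simp add: AR mult.commute)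
qed


section \<open>The flat torus as a quotient of the plane\<close>

definition P :: "complex \<Rightarrow> complex \<times> complex" where
  "P z = (cis (2 * pi / L * Re z), cis (c * Im z + \<beta> * Re z))"

text \<open>\<open>P\<close> is a homomorphism, so its fibres are the orbits of a group of translations.\<close>

lemma P_add: "P (z + w) = (fst (P z) * fst (P w), snd (P z) * snd (P w))"
  by (simp add: P_def cis_mult algebra_simps add_divide_distrib)

lemma P_translation:
  assumes "P z = P w"
  shows "P (u + (w - z)) = P u"
proof -
  have "P (z + (w - z)) = P z" using assms by simp
  then have "P (w - z) = (1, 1)"
    unfolding P_add[of z "w - z"] by (simp add: P_def prod_eq_iff)
  then show ?thesis by (simp add: P_add[of u])
qed

lemma P_in_torus: "P z \<in> torus"
  by (simp add: P_def torus_def)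

lemma continuous_on_P: "continuous_on A P"
  unfolding P_def cis_conv_exp by (intro continuous_intros)

text \<open>
  Two points in a disc of radius \<open>\<rho>\<close> have abscissae that differ by less than the period \<open>L\<close>, and ordinates that
  differ by less than the length \<open>2 * pi / \<bar>c\<bar>\<close> of the period along the fibres.
\<close>

definition \<rho> :: real where "\<rho> = min (L / 2) (pi / \<bar>c\<bar>)"

lemma \<rho>_pos: "\<rho> > 0" using L c_nonzero by (simp add: \<rho>_def)

lemma inj_on_P: "inj_on P (ball z \<rho>)"
proof (rule inj_onI)
  fix v w assume vw: "v \<in> ball z \<rho>" "w \<in> ball z \<rho>" and eq: "P v = P w"
  have "dist v w < 2 * \<rho>" using vw dist_triangle_half_r[of z v "2 * \<rho>" w] by simp
  then have d: "cmod (w - v) < 2 * \<rho>" by (simp add: dist_norm norm_minus_commute)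
  have "P (0 + (w - v)) = P 0" by (rule P_translation[OF eq])
  then have 1: "cis (2 * pi / L * Re (w - v)) = 1" "cis (c * Im (w - v) + \<beta> * Re (w - v)) = 1"
    by (simp_all add: P_def)
  have zero: "t = 0" if "cis t = 1" "\<bar>t\<bar> < 2 * pi" for t
  proof -
    from cis_eq_1_imp[OF that(1)] obtain n :: int where n: "t = 2 * pi * n" by blast
    then have "\<bar>real_of_int n\<bar> < 1" using that(2) by (simp add: abs_mult)
    then show ?thesis using n by simp
  qed
  have "\<bar>Re (w - v)\<bar> < L" "\<bar>Im (w - v)\<bar> < 2 * pi / \<bar>c\<bar>"
    using d abs_Re_le_cmod[of "w - v"] abs_Im_le_cmod[of "w - v"] by (simp_all add: \<rho>_def)
  then have b: "\<bar>2 * pi / L * Re (w - v)\<bar> < 2 * pi" "\<bar>c * Im (w - v)\<bar> < 2 * pi"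
    using L c_nonzero mult_strict_left_mono[of "\<bar>Re (w - v)\<bar>" L "2 * pi / L"]
      mult_strict_left_mono[of "\<bar>Im (w - v)\<bar>" "2 * pi / \<bar>c\<bar>" "\<bar>c\<bar>"] by (simp_all add: abs_mult)
  from zero[OF 1(1) b(1)] have re: "Re (w - v) = 0" using L by simp
  then have "Im (w - v) = 0" using zero[OF _ b(2)] 1(2) c_nonzero by simp
  with re show "v = w" by (simp add: complex_eq_iff)
qed

text \<open>A branch of the inverse of \<open>P\<close> near \<open>P z\<close>.\<close>

definition P_inv :: "complex \<Rightarrow> complex \<times> complex \<Rightarrow> complex" where
  "P_inv z p = (let x = L / (2 * pi) * Arg (fst p / fst (P z)) in
     z + Complex x ((Arg (snd p / snd (P z)) - \<beta> * x) / c))"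

lemma P_P_inv:
  assumes "p \<in> torus"
  shows "P (P_inv z p) = p"
proof -
  have p: "cmod (fst p) = 1" "cmod (snd p) = 1" using assms by (auto simp: torus_def)
  have n: "cmod (fst p / fst (P z)) = 1" "cmod (snd p / snd (P z)) = 1" "fst (P z) \<noteq> 0" "snd (P z) \<noteq> 0"
    using p by (simp_all add: P_def norm_divide)
  have "P (P_inv z p) = (fst (P z) * (fst p / fst (P z)), snd (P z) * (snd p / snd (P z)))"
    unfolding P_inv_def Let_def P_add[of z]
    unfolding P_def[of "Complex _ _"] using L c_nonzero by (simp add: cis_Arg_unit n(1,2))
  then show ?thesis using n by simp
qed

lemma P_inv_P: "P_inv z (P z) = z"
proof -
  have "fst (P z) \<noteq> 0" "snd (P z) \<noteq> 0" by (simp_all add: P_def del: cis.simps)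
  then show ?thesis by (simp add: P_inv_def zero_complex.code[symmetric])
qed

lemma isCont_P_inv: "isCont (P_inv z) (P z)"
proof -
  have "isCont (\<lambda>p. Arg (fst p / fst (P z))) (P z)" "isCont (\<lambda>p. Arg (snd p / snd (P z))) (P z)"
    using isCont_o2[of "P z" "\<lambda>p. fst p / fst (P z)" Arg] isCont_o2[of "P z" "\<lambda>p. snd p / snd (P z)" Arg]
      continuous_at_Arg[of 1] by (simp_all add: P_def)
  then show ?thesis
    unfolding P_inv_def Let_def Complex_eq using c_nonzero by (intro continuous_intros) auto
qed

lemma P_surj: "p \<in> torus \<Longrightarrow> \<exists>z. P z = p"
  using P_P_inv by blast

lemma openin_P_image:
  assumes "open U"
  shows "openin (top_of_set torus) (P ` U)"
  unfolding openin_euclidean_subtopology_iff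
proof (intro conjI ballI)
  show "P ` U \<subseteq> torus" using P_in_torus by auto
  fix p assume "p \<in> P ` U"
  then obtain z where z: "z \<in> U" "p = P z" by auto
  then obtain e where e: "e > 0" "ball z e \<subseteq> U" using assms openE by blast
  obtain d where d: "d > 0" "\<And>p'. dist p' (P z) < d \<Longrightarrow> dist (P_inv z p') z < e"
    using isCont_P_inv[of z] e(1) unfolding continuous_at_eps_delta P_inv_P by blast
  have "p' \<in> P ` U" if "p' \<in> torus" "dist p' p < d" for p'
  proof -
    have "P_inv z p' \<in> U" using d(2)[of p'] that z e by (auto simp: dist_commute)
    then show ?thesis using P_P_inv[OF that(1), of z] by (metis image_eqI)
  qed
  then show "\<exists>e>0. \<forall>x'\<in>torus. dist x' p < e \<longrightarrow> x' \<in> P ` U" using d(1) by blast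
qed

lemma topological_param_P:
  assumes "open U" "inj_on P U"
  shows "topological_param (top_of_set torus) (U, P)"
proof -
  have "continuous_map (top_of_set U) (top_of_set torus) P"
    using continuous_on_P P_in_torus by (auto simp: continuous_map_in_subtopology)
  moreover have "open_map (top_of_set U) (top_of_set torus) P"
    unfolding open_map_def using openin_P_image assms(1) by (metis openin_open_eq)
  ultimately have "embedding_map (top_of_set U) (top_of_set torus) P"
    using assms(2) by (intro injective_open_imp_embedding_map) auto
  then show ?thesis using assms(1) openin_P_image by (simp add: topological_param_def)
qed

text \<open>
  Near a point \<open>z\<close> the transition map is the translation by \<open>\<phi> z - z\<close>: this translation preserves \<open>P\<close>, and
  \<open>P\<close> is injective on \<open>V\<close>.
\<close>

lemma transition_P:
  assumes U: "open U" and V: "open V" "inj_on P V"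
  shows "smooth_oriented_transition (U, P) (V, P)"
proof -
  define \<phi> where "\<phi> z = inv_into V P (P z)" for z
  define W where "W = {z \<in> U. P z \<in> P ` V}"
  have "open {z. P z \<in> P ` V}"
  proof -
    obtain O' where O': "open O'" "P ` V = torus \<inter> O'"
      using openin_P_image[OF V(1)] by (auto simp: openin_open)
    have "{z. P z \<in> P ` V} = P -` O'" unfolding O'(2) using P_in_torus by auto
    then show ?thesis using open_vimage[OF O'(1) continuous_on_P] by simp
  qed
  then have W: "open W" using U by (simp add: W_def Collect_conj_eq open_Int)
  have tr: "\<exists>a. \<forall>\<^sub>F w in nhds z. \<phi> w = w + a" if "z \<in> W" for z
  proof (intro exI)
    have "P z \<in> P ` V" using that by (simp add: W_def)
    then have \<phi>z: "\<phi> z \<in> V" "P (\<phi> z) = P z" by (simp_all add: \<phi>_def inv_into_into f_inv_into_f)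
    have "open ((\<lambda>w. w + (\<phi> z - z)) -` V)" by (intro open_vimage V continuous_intros)
    then have "\<forall>\<^sub>F w in nhds z. w + (\<phi> z - z) \<in> V"
      unfolding eventually_nhds using \<phi>z(1) by (intro exI conjI) auto
    then show "\<forall>\<^sub>F w in nhds z. \<phi> w = w + (\<phi> z - z)"
    proof eventually_elim
      case (elim w)
      have "P w = P (w + (\<phi> z - z))" using P_translation[OF \<phi>z(2)[symmetric]] by simp
      then show ?case using elim V(2) by (simp add: \<phi>_def)
    qed
  qed
  have "smooth_on \<phi> W" "\<And>z. z \<in> W \<Longrightarrow> frechet_derivative \<phi> (at z) = (\<lambda>v. v)"
    using locally_translation_smooth[OF W tr] by auto
  then have "smooth_on \<phi> W \<and> (\<forall>z\<in>W. Im (cnj (frechet_derivative \<phi> (at z) 1) * frechet_derivative \<phi> (at z) \<i>) > 0)"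
    by simp
  then show ?thesis
    unfolding smooth_oriented_transition_def Let_def prod.case \<phi>_def W_def .
qed

definition atlas :: "(complex \<times> complex) param set" where
  "atlas = {(U, P) | U. open U \<and> inj_on P U}"

lemma oriented_param_P:
  assumes "open U" "inj_on P U"
  shows "oriented_param (top_of_set torus) atlas (U, P)"
  using assms topological_param_P transition_P by (auto simp: oriented_param_def atlas_def)

lemma oriented_param_around:
  assumes "p \<in> torus"
  obtains z where "P z = p" "(ball z \<rho>, P) \<in> atlas" "p \<in> P ` ball z \<rho>"
  using P_surj[OF assms] inj_on_P \<rho>_pos by (fastforce simp: atlas_def)

lemma oriented_surface_torus: "oriented_surface (top_of_set torus) atlas"
  unfolding oriented_surface_def
proof (intro conjI)
  show "Hausdorff_space (top_of_set torus)"
    by (simp add: Hausdorff_space_subtopology)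
  show "second_countable (top_of_set torus)"
  proof (rule second_countable_subtopology)
    obtain B :: "(complex \<times> complex) set set" where "countable B" "topological_basis B"
      using ex_countable_basis by blast
    then show "second_countable (euclidean :: (complex \<times> complex) topology)"
      unfolding second_countable_def open_openin[symmetric]
      by (metis topological_basis_open topological_basisE)
  qed
  have "torus = P ` UNIV" using P_in_torus by (auto dest!: P_surj intro: range_eqI[OF sym])
  then show "connected_space (top_of_set torus)"
    using connected_continuous_image[OF continuous_on_P connected_UNIV]
    by (intro connected_space_subtopology) simp
  show "\<forall>c\<in>atlas. oriented_param (top_of_set torus) atlas c"
    using oriented_param_P by (auto simp: atlas_def)
  show "(\<Union>(U, f)\<in>atlas. f ` U) = topspace (top_of_set torus)"
  proof (intro equalityI subsetI)
    fix p assume "p \<in> topspace (top_of_set torus)"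
    then have "p \<in> torus" by simp
    then obtain z where "(ball z \<rho>, P) \<in> atlas" "p \<in> P ` ball z \<rho>"
      by (rule oriented_param_around)
    then show "p \<in> (\<Union>(U, f)\<in>atlas. f ` U)" by blast
  qed (use P_in_torus in \<open>auto simp: atlas_def\<close>)
qed

lemma compact_torus: "compact torus"
  by (simp add: torus_def compact_Times)

lemma torus_space_torus: "torus_space (top_of_set torus)"
  by (simp add: torus_space_def torus_def)


section \<open>The Hopf torus\<close>

text \<open>Composing the lift \<open>\<zeta>\<close> with the rotation that undoes its holonomy makes it periodic.\<close>

definition \<psi> :: "complex \<times> complex \<Rightarrow> C2" where
  "\<psi> p = (let x = L / (2 * pi) * Arg (fst p) in rot (Arg (snd p) - \<beta> * x) (\<zeta> x))"

lemma closing_int: "\<zeta> (x + of_int n * L) = rot (\<beta> * (of_int n * L)) (\<zeta> x)"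
proof (induction n rule: int_induct[of _ 0])
  case (step1 i)
  have "\<zeta> (x + of_int (i + 1) * L) = rot (\<beta> * L) (\<zeta> (x + of_int i * L))"
    using closing[of "x + of_int i * L"] by (simp add: algebra_simps)
  then show ?case using step1 by (simp add: algebra_simps)
next
  case (step2 i)
  have "rot (\<beta> * L) (\<zeta> (x + of_int (i - 1) * L)) = \<zeta> (x + of_int i * L)"
    using closing[of "x + of_int (i - 1) * L"] by (simp add: algebra_simps)
  then have "rot (- (\<beta> * L)) (rot (\<beta> * L) (\<zeta> (x + of_int (i - 1) * L)))
      = rot (- (\<beta> * L)) (rot (\<beta> * (of_int i * L)) (\<zeta> x))" using step2 by simp
  then show ?case by (simp add: algebra_simps)
qed simp

lemma \<psi>_P: "\<psi> (P z) = R z"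
proof -
  have Arg: "\<exists>n::int. Arg (cis t) = t + 2 * pi * n" for t
  proof -
    have "cis (Arg (cis t) - t) = 1" by (simp add: cis_Arg_unit flip: cis_divide)
    from cis_eq_1_imp[OF this] obtain n :: int where "Arg (cis t) - t = 2 * pi * n" by blast
    then show ?thesis by (intro exI[of _ n]) simp
  qed
  define t where "t = c * Im z + \<beta> * Re z"
  obtain n :: int where n: "Arg (cis (2 * pi / L * Re z)) = 2 * pi / L * Re z + 2 * pi * n" using Arg by blast
  obtain k :: int where k: "Arg (cis t) = t + 2 * pi * k" using Arg by blast
  have x: "L / (2 * pi) * (2 * pi / L * Re z + 2 * pi * n) = Re z + of_int n * L"
    using L by (simp add: field_simps)
  have "\<psi> (P z) = rot (t + 2 * pi * k - \<beta> * (Re z + of_int n * L) + \<beta> * (of_int n * L)) (\<zeta> (Re z))"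
    unfolding \<psi>_def Let_def P_def fst_conv snd_conv t_def[symmetric] n k x closing_int by simp
  also have "t + 2 * pi * k - \<beta> * (Re z + of_int n * L) + \<beta> * (of_int n * L) = c * Im z + 2 * pi * k"
    by (simp add: t_def algebra_simps)
  also have "rot (c * Im z + 2 * pi * k) (\<zeta> (Re z)) = R z"
    by (simp add: rot_def R_def flip: cis_mult)
  finally show ?thesis .
qed

lemma \<psi>_comp_P [simp]: "\<psi> \<circ> P = R"
  by (rule ext) (simp add: \<psi>_P)

lemma smooth_immersion_\<psi>: "smooth_immersion (top_of_set torus) atlas \<psi>"
  unfolding smooth_immersion_def
proof (intro conjI)
  show "\<psi> ` topspace (top_of_set torus) \<subseteq> S3"
  proof
    fix y assume "y \<in> \<psi> ` topspace (top_of_set torus)"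
    then obtain p where "p \<in> torus" "y = \<psi> p" by auto
    then obtain z where "y = \<psi> (P z)" using P_surj by blast
    then show "y \<in> S3" using R_in_S3 by (simp only: \<psi>_P)
  qed
  show "\<forall>(U, f)\<in>atlas. smooth_on (\<psi> \<circ> f) U \<and> (\<forall>z\<in>U. inj (patch_d (\<psi> \<circ> f) z))"
    using inj_patch_d_R Ck_on_subset[OF smooth_R] by (auto simp: atlas_def smooth_on_def)
qed

lemma not_constant_mean_curvature_\<psi>: "\<not> constant_mean_curvature \<kappa> \<tau> atlas \<psi>"
proof
  assume "constant_mean_curvature \<kappa> \<tau> atlas \<psi>"
  then obtain a where a: "\<And>U f z. (U, f) \<in> atlas \<Longrightarrow> z \<in> U \<Longrightarrow> mean_curvature \<kappa> \<tau> (\<psi> \<circ> f) z = a"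
    unfolding constant_mean_curvature_def by blast
  have "sqrt \<kappa> / 2 * q x = a" for x
    using a[of "ball (of_real x) \<rho>" P "of_real x"] inj_on_P \<rho>_pos
    by (auto simp: atlas_def mean_curvature_R)
  then have "q x = a / (sqrt \<kappa> / 2)" for x using \<kappa> by (simp add: field_simps)
  then show False using q_nonconst by metis
qed

text \<open>
  An oriented conformal parameter is related to the sheets of \<open>P\<close> by a transition map, so that locally
  the surface is \<open>R \<circ> \<phi>\<close> and the bound for conformal parameters of the cylinder applies.
\<close>

lemma AR_inequality_\<psi>: "AR_inequality \<kappa> \<tau> (top_of_set torus) atlas \<psi> (\<lambda>_. h\<^sub>0)"
  unfolding AR_inequality_def
proof (intro ballI conjI allI impI)
  fix p assume "p \<in> topspace (top_of_set torus)"
  then have p: "p \<in> torus" by simp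
  from p obtain z where z: "P z = p" "(ball z \<rho>, P) \<in> atlas" "p \<in> P ` ball z \<rho>"
    by (rule oriented_param_around)
  have "conformal_on \<kappa> \<tau> R (ball z \<rho>)"
    unfolding conformal_on_def patch_metric_R using \<kappa> by (intro ballI exI[of _ "4 / \<kappa>"]) auto
  then have "conformal_param \<kappa> \<tau> (top_of_set torus) atlas \<psi> (ball z \<rho>, P)"
    using oriented_param_P[OF open_ball inj_on_P] by (simp add: conformal_param_def)
  then show "\<exists>U f. conformal_param \<kappa> \<tau> (top_of_set torus) atlas \<psi> (U, f) \<and> p \<in> f ` U"
    using z by blast
  fix U f w assume w: "w \<in> U"
    and "conformal_param \<kappa> \<tau> (top_of_set torus) atlas \<psi> (U, f) \<and> f w = p"
  then have par: "oriented_param (top_of_set torus) atlas (U, f)"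
    and conf: "conformal_on \<kappa> \<tau> (\<psi> \<circ> f) U" and fw: "f w = p"
    by (auto simp: conformal_param_def)
  define V where "V = ball z \<rho>"
  define \<phi> where "\<phi> = (\<lambda>z. inv_into V P (f z))"
  define W where "W = {z \<in> U. f z \<in> P ` V}"
  have top: "open U" "embedding_map (top_of_set U) (top_of_set torus) f"
    using par by (auto simp: oriented_param_def topological_param_def)
  have "smooth_oriented_transition (U, f) (V, P)"
    using par z(2) unfolding oriented_param_def V_def by blast
  then have \<phi>: "smooth_on \<phi> W"
    "\<And>z. z \<in> W \<Longrightarrow> Im (cnj (frechet_derivative \<phi> (at z) 1) * frechet_derivative \<phi> (at z) \<i>) > 0"
    unfolding smooth_oriented_transition_def by (auto simp: Let_def \<phi>_def W_def)
  have W: "open W" "w \<in> W"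
  proof -
    have "continuous_map (top_of_set U) (top_of_set torus) f"
      using homeomorphic_imp_continuous_map[OF top(2)[unfolded embedding_map_def]]
      by (rule continuous_map_into_fulltopology)
    from openin_continuous_map_preimage[OF this openin_P_image[of V]]
    have "openin (top_of_set U) W" by (simp add: V_def W_def)
    then show "open W" using top(1) openin_open_eq by blast
    show "w \<in> W" using w fw z(3) by (simp add: W_def V_def)
  qed
  have "\<phi> differentiable (at z)" if "z \<in> W" for z
    using \<phi>(1) that unfolding smooth_on_def by (metis Ck_on.simps(2))
  moreover have "(\<psi> \<circ> f) z = R (\<phi> z)" if "z \<in> W" for z
    using that by (simp add: W_def \<phi>_def f_inv_into_f flip: \<psi>_P)
  moreover have "conformal_on \<kappa> \<tau> (\<psi> \<circ> f) W"
    using conf by (simp add: conformal_on_def W_def)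
  ultimately show "dH_norm \<kappa> \<tau> (\<psi> \<circ> f) w \<le> h\<^sub>0 * AR_norm \<kappa> \<tau> (\<psi> \<circ> f) w"
    by (intro AR_bound_in_conformal_param[OF W _ \<phi>(2)])
qed

end


section \<open>The induced distance and completeness\<close>

lemma berger_metric_nonneg:
  assumes "\<kappa> > 0" "p \<in> S3"
  shows "berger_metric \<kappa> \<tau> p V V \<ge> 0"
proof -
  have "(V \<bullet> times_i p)\<^sup>2 \<le> V \<bullet> V"
    using Cauchy_Schwarz_ineq[of V "times_i p"] S3_inner[OF assms(2)] by simp
  moreover have "4 * \<tau>\<^sup>2 / \<kappa> * (V \<bullet> times_i p)\<^sup>2 \<ge> 0" using assms(1) by simp
  ultimately have "V \<bullet> V + (4 * \<tau>\<^sup>2 / \<kappa> - 1) * (V \<bullet> times_i p)\<^sup>2 \<ge> 0"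
    by (simp add: algebra_simps)
  then show ?thesis
    using assms(1) by (simp add: berger_metric_def power2_eq_square mult.assoc)
qed

text \<open>
  A concatenated curve runs through each of its parts at double speed on half of the unit interval, so
  lengths add up; the finitely many points where it is not differentiable do not affect the integral.
\<close>

lemma speed_reparam:
  assumes "open I" "t \<in> I" "\<And>s. s \<in> I \<Longrightarrow> h s = g (2 * s - k)" "g differentiable (at (2 * t - k))"
  shows "speed \<kappa> \<tau> h t = 2 * speed \<kappa> \<tau> g (2 * t - k)"
proof -
  define V where "V = vector_derivative g (at (2 * t - k))"
  have "(g has_vector_derivative V) (at (2 * t - k))"
    using assms(4) by (simp add: V_def vector_derivative_works)
  moreover have "((\<lambda>s. 2 * s - k) has_vector_derivative 2) (at t)"
    by (auto intro!: derivative_eq_intros)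
  ultimately have "((\<lambda>s. g (2 * s - k)) has_vector_derivative 2 *\<^sub>R V) (at t)"
    using vector_diff_chain_at[of "\<lambda>s. 2 * s - k" 2 t g V] by (simp add: o_def)
  then have "(h has_vector_derivative 2 *\<^sub>R V) (at t)"
    by (rule has_vector_derivative_transform_within_open[OF _ assms(1,2)]) (simp add: assms(3))
  then have "vector_derivative h (at t) = 2 *\<^sub>R V" by (rule vector_derivative_at)
  then show ?thesis
    using assms(2,3) by (simp add: speed_def V_def berger_metric_simps real_sqrt_mult flip: mult.assoc)
qed

lemma length_half:
  assumes "valid_path g" "(speed \<kappa> \<tau> g has_integral i) {0..1}"
    and h: "\<And>s. s \<in> {k / 2 <..< (k + 1) / 2} \<Longrightarrow> h s = g (2 * s - k)"
  shows "(speed \<kappa> \<tau> h has_integral i) {k / 2..(k + 1) / 2}"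
proof -
  obtain F where F: "finite F" "\<And>x. x \<in> {0..1} - F \<Longrightarrow> g differentiable (at x)"
    using assms(1) by (auto simp: valid_path_def piecewise_C1_differentiable_on_def C1_differentiable_on_eq)
  have im: "(\<lambda>x. x / 2 + k / 2) ` {0..1} = {k / 2..(k + 1) / 2}"
    using image_affinity_atLeastAtMost[of "1 / 2" "k / 2" 0 "1::real"] by (simp add: add_divide_distrib add.commute)
  have "((\<lambda>x. speed \<kappa> \<tau> g (2 * x + - k)) has_integral i / 2) {k / 2..(k + 1) / 2}"
    using has_integral_affinity[OF assms(2)[unfolded box_real(2)[symmetric]], of 2 "- k"] im by simp
  from has_integral_mult_right[OF this, of 2]
  have "((\<lambda>x. 2 * speed \<kappa> \<tau> g (2 * x - k)) has_integral i) {k / 2..(k + 1) / 2}" by simp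
  then show ?thesis
  proof (rule has_integral_spike_finite[rotated 2])
    show "finite ({k / 2, (k + 1) / 2} \<union> (\<lambda>x. (x + k) / 2) ` F)" using F(1) by simp
    fix t assume t: "t \<in> {k / 2..(k + 1) / 2} - ({k / 2, (k + 1) / 2} \<union> (\<lambda>x. (x + k) / 2) ` F)"
    then have "2 * t - k \<notin> F" by (auto simp: image_iff)
    then have "g differentiable (at (2 * t - k))" using t by (intro F(2)) auto
    then show "speed \<kappa> \<tau> h t = 2 * speed \<kappa> \<tau> g (2 * t - k)"
      using t by (intro speed_reparam[of "{k / 2 <..< (k + 1) / 2}"] h) auto
  qed
qed

text \<open>The curves over which \<open>induced_dist\<close> is the infimum.\<close>

definition connecting :: "real \<Rightarrow> real \<Rightarrow> 'm topology \<Rightarrow> ('m \<Rightarrow> C2) \<Rightarrow> 'm \<Rightarrow> 'm \<Rightarrow> (real \<Rightarrow> 'm) \<Rightarrow> bool" where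
  "connecting \<kappa> \<tau> T \<psi> a b c \<longleftrightarrow> pathin T c \<and> c 0 = a \<and> c 1 = b \<and> valid_path (\<psi> \<circ> c) \<and>
     speed \<kappa> \<tau> (\<psi> \<circ> c) integrable_on {0..1}"

lemma induced_dist_connecting:
  "induced_dist \<kappa> \<tau> T \<psi> a b = Inf {integral {0..1} (speed \<kappa> \<tau> (\<psi> \<circ> c)) | c. connecting \<kappa> \<tau> T \<psi> a b c}"
  by (simp add: induced_dist_def connecting_def)

context
  fixes \<kappa> \<tau> :: real and M :: "'m::topological_space set" and \<psi> :: "'m \<Rightarrow> C2"
  assumes \<kappa>: "\<kappa> > 0" and \<psi>: "\<psi> ` M \<subseteq> S3"
begin

lemma length_nonneg:
  assumes "connecting \<kappa> \<tau> (top_of_set M) \<psi> a b c"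
  shows "integral {0..1} (speed \<kappa> \<tau> (\<psi> \<circ> c)) \<ge> 0"
proof (rule integral_nonneg)
  fix t :: real assume "t \<in> {0..1}"
  then have "c t \<in> M" using assms by (auto simp: connecting_def pathin_canon_iff)
  then have "\<psi> (c t) \<in> S3" using \<psi> by blast
  then show "0 \<le> speed \<kappa> \<tau> (\<psi> \<circ> c) t"
    unfolding speed_def by (intro real_sqrt_ge_zero berger_metric_nonneg[OF \<kappa>]) (simp only: o_apply)
qed (use assms in \<open>simp add: connecting_def\<close>)

lemma induced_dist_le_length:
  assumes "connecting \<kappa> \<tau> (top_of_set M) \<psi> a b c"
  shows "induced_dist \<kappa> \<tau> (top_of_set M) \<psi> a b \<le> integral {0..1} (speed \<kappa> \<tau> (\<psi> \<circ> c))"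
  unfolding induced_dist_connecting
  by (rule cInf_lower) (use assms length_nonneg in \<open>auto intro: bdd_belowI[of _ 0]\<close>)

lemma induced_dist_nonneg:
  assumes "connecting \<kappa> \<tau> (top_of_set M) \<psi> a b c"
  shows "induced_dist \<kappa> \<tau> (top_of_set M) \<psi> a b \<ge> 0"
  unfolding induced_dist_connecting
  by (rule cInf_greatest) (use assms length_nonneg in auto)

lemma connecting_join:
  assumes c: "connecting \<kappa> \<tau> (top_of_set M) \<psi> x y c" and d: "connecting \<kappa> \<tau> (top_of_set M) \<psi> y z d"
  shows "connecting \<kappa> \<tau> (top_of_set M) \<psi> x z (c +++ d)"
    and "integral {0..1} (speed \<kappa> \<tau> (\<psi> \<circ> (c +++ d)))
      = integral {0..1} (speed \<kappa> \<tau> (\<psi> \<circ> c)) + integral {0..1} (speed \<kappa> \<tau> (\<psi> \<circ> d))"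
proof -
  have ends: "pathfinish c = pathstart d" "c 0 = x" "d 1 = z" "c 1 = y" "d 0 = y"
    using c d by (simp_all add: connecting_def pathfinish_def pathstart_def)
  have pc: "path c" "c \<in> {0..1} \<rightarrow> M" and pd: "path d" "d \<in> {0..1} \<rightarrow> M"
    using c d by (simp_all add: connecting_def pathin_canon_iff)
  have pin: "pathin (top_of_set M) (c +++ d)"
    unfolding pathin_canon_iff
  proof (intro conjI)
    show "path (c +++ d)" using pc pd ends by (intro path_join_imp)
    show "c +++ d \<in> {0..1} \<rightarrow> M" using pc(2) pd(2) by (auto simp: joinpaths_def Pi_iff)
  qed
  have valid: "valid_path (\<psi> \<circ> (c +++ d))"
    unfolding path_compose_join using c d ends
    by (intro valid_path_join) (simp_all add: connecting_def pathfinish_def pathstart_def)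
  have I: "(speed \<kappa> \<tau> (\<psi> \<circ> c) has_integral integral {0..1} (speed \<kappa> \<tau> (\<psi> \<circ> c))) {0..1}"
    "(speed \<kappa> \<tau> (\<psi> \<circ> d) has_integral integral {0..1} (speed \<kappa> \<tau> (\<psi> \<circ> d))) {0..1}"
    using c d by (simp_all add: connecting_def integrable_integral)
  have "(speed \<kappa> \<tau> (\<psi> \<circ> (c +++ d)) has_integral integral {0..1} (speed \<kappa> \<tau> (\<psi> \<circ> c))) {0..1/2}"
    using length_half[of "\<psi> \<circ> c" \<kappa> \<tau> _ 0 "\<psi> \<circ> (c +++ d)"] c I(1) by (simp add: connecting_def joinpaths_def)
  moreover have "(speed \<kappa> \<tau> (\<psi> \<circ> (c +++ d)) has_integral integral {0..1} (speed \<kappa> \<tau> (\<psi> \<circ> d))) {1/2..1}"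
    using length_half[of "\<psi> \<circ> d" \<kappa> \<tau> _ 1 "\<psi> \<circ> (c +++ d)"] d I(2) by (simp add: connecting_def joinpaths_def)
  ultimately have J: "(speed \<kappa> \<tau> (\<psi> \<circ> (c +++ d)) has_integral
      integral {0..1} (speed \<kappa> \<tau> (\<psi> \<circ> c)) + integral {0..1} (speed \<kappa> \<tau> (\<psi> \<circ> d))) {0..1}"
    by (intro has_integral_combine[of 0 "1/2" 1]) auto
  then show "integral {0..1} (speed \<kappa> \<tau> (\<psi> \<circ> (c +++ d)))
      = integral {0..1} (speed \<kappa> \<tau> (\<psi> \<circ> c)) + integral {0..1} (speed \<kappa> \<tau> (\<psi> \<circ> d))"
    by (rule integral_unique)
  show "connecting \<kappa> \<tau> (top_of_set M) \<psi> x z (c +++ d)"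
    using pin valid J ends by (auto simp: connecting_def joinpaths_def integrable_on_def)
qed

lemma induced_dist_triangle:
  assumes "connecting \<kappa> \<tau> (top_of_set M) \<psi> x y c\<^sub>0" "connecting \<kappa> \<tau> (top_of_set M) \<psi> y z d\<^sub>0"
  shows "induced_dist \<kappa> \<tau> (top_of_set M) \<psi> x z
    \<le> induced_dist \<kappa> \<tau> (top_of_set M) \<psi> x y + induced_dist \<kappa> \<tau> (top_of_set M) \<psi> y z"
proof -
  let ?d = "induced_dist \<kappa> \<tau> (top_of_set M) \<psi>" and ?l = "\<lambda>c. integral {0..1} (speed \<kappa> \<tau> (\<psi> \<circ> c))"
  have "?d x z - ?l c \<le> ?d y z" if c: "connecting \<kappa> \<tau> (top_of_set M) \<psi> x y c" for c
    unfolding induced_dist_connecting[of \<kappa> \<tau> _ \<psi> y z]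
  proof (rule cInf_greatest, use assms(2) in blast)
    fix l assume "l \<in> {?l d | d. connecting \<kappa> \<tau> (top_of_set M) \<psi> y z d}"
    then obtain d where d: "l = ?l d" "connecting \<kappa> \<tau> (top_of_set M) \<psi> y z d" by blast
    show "?d x z - ?l c \<le> l"
      using induced_dist_le_length[OF connecting_join(1)[OF c d(2)]] connecting_join(2)[OF c d(2)] d(1) by simp
  qed
  then have "?d x z - ?d y z \<le> l" if "l \<in> {?l c | c. connecting \<kappa> \<tau> (top_of_set M) \<psi> x y c}" for l
    using that by force
  then have "?d x z - ?d y z \<le> ?d x y"
    unfolding induced_dist_connecting[of \<kappa> \<tau> _ \<psi> x y] using assms(1) by (intro cInf_greatest) blast+
  then show ?thesis by simp
qed

end

context hopf_cylinder
begin

text \<open>Straight segments of the plane give curves of the expected length on the flat torus.\<close>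

lemma connecting_segment:
  "connecting \<kappa> \<tau> (top_of_set torus) \<psi> (P z) (P w) (P \<circ> linepath z w)"
  "integral {0..1} (speed \<kappa> \<tau> (\<psi> \<circ> (P \<circ> linepath z w))) = sqrt (4 / \<kappa>) * cmod (w - z)"
proof -
  have comp: "\<psi> \<circ> (P \<circ> linepath z w) = R \<circ> linepath z w"
    by (simp add: fun_eq_iff \<psi>_P)
  have D: "((R \<circ> linepath z w) has_vector_derivative patch_d R (linepath z w t) (w - z)) (at t)" for t
  proof -
    have "(linepath z w has_derivative (\<lambda>h. h *\<^sub>R (w - z))) (at t)"
      using has_vector_derivative_linepath_within[of z w t UNIV] by (simp add: has_vector_derivative_def)
    from diff_chain_at[OF this R_deriv] show ?thesis
      by (simp add: has_vector_derivative_def o_def patch_d_R algebra_simps)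
  qed
  have sp: "speed \<kappa> \<tau> (R \<circ> linepath z w) = (\<lambda>t. sqrt (4 / \<kappa>) * cmod (w - z))"
  proof
    fix t
    have "speed \<kappa> \<tau> (R \<circ> linepath z w) t = sqrt (patch_metric \<kappa> \<tau> R (linepath z w t) (w - z) (w - z))"
      by (simp add: speed_def vector_derivative_at[OF D] patch_metric_def)
    then show "speed \<kappa> \<tau> (R \<circ> linepath z w) t = sqrt (4 / \<kappa>) * cmod (w - z)"
      by (simp add: patch_metric_R dot_square_norm real_sqrt_mult real_sqrt_divide)
  qed
  have "pathin (top_of_set torus) (P \<circ> linepath z w)"
    unfolding pathin_canon_iff
    using P_in_torus by (auto intro!: path_continuous_image continuous_on_P)
  moreover have "valid_path (R \<circ> linepath z w)"
    unfolding valid_path_def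
  proof (rule C1_differentiable_imp_piecewise)
    have "continuous_on UNIV (\<lambda>x. frechet_derivative R (at x) (w - z))"
      using smooth_R[of "Suc 0"] by simp
    then have "continuous_on {0..1} (\<lambda>t. frechet_derivative R (at (linepath z w t)) (w - z))"
      by (rule continuous_on_compose2) auto
    then show "(R \<circ> linepath z w) C1_differentiable_on {0..1}"
      unfolding C1_differentiable_on_def using D
      by (intro exI[of _ "\<lambda>t. patch_d R (linepath z w t) (w - z)"]) (auto simp: patch_d_def)
  qed
  ultimately show "connecting \<kappa> \<tau> (top_of_set torus) \<psi> (P z) (P w) (P \<circ> linepath z w)"
    by (simp add: connecting_def comp sp linepath_0' linepath_1' integrable_const_ivl)
  show "integral {0..1} (speed \<kappa> \<tau> (\<psi> \<circ> (P \<circ> linepath z w))) = sqrt (4 / \<kappa>) * cmod (w - z)"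
    by (simp add: comp sp)
qed

lemma bounded_P_inv: "bounded (P_inv 0 ` torus)"
proof (rule boundedI)
  fix z assume "z \<in> P_inv 0 ` torus"
  then obtain p where z: "z = P_inv 0 p" by blast
  define x where "x = L / (2 * pi) * Arg (fst p)"
  have Arg: "\<bar>Arg w\<bar> \<le> pi" for w using Arg_bounded[of w] by linarith
  have x: "\<bar>x\<bar> \<le> L / 2"
    using mult_left_mono[OF Arg[of "fst p"], of "L / (2 * pi)"] L by (simp add: x_def abs_mult)
  have "\<bar>Arg (snd p) - \<beta> * x\<bar> \<le> pi + \<bar>\<beta>\<bar> * (L / 2)"
    using Arg[of "snd p"] mult_left_mono[OF x, of "\<bar>\<beta>\<bar>"] by (simp add: abs_mult[symmetric])
  then have y: "\<bar>(Arg (snd p) - \<beta> * x) / c\<bar> \<le> (pi + \<bar>\<beta>\<bar> * (L / 2)) / \<bar>c\<bar>"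
    by (simp add: divide_right_mono)
  have "z = Complex x ((Arg (snd p) - \<beta> * x) / c)"
    by (simp add: z P_inv_def P_def x_def)
  then show "cmod z \<le> L / 2 + (pi + \<bar>\<beta>\<bar> * (L / 2)) / \<bar>c\<bar>"
    using cmod_le[of z] x y by simp
qed

text \<open>
  A Cauchy sequence lifts to a bounded sequence in the plane.  A subsequence of the lift converges, hence so does its
  image, because segments bound the distance from above; by the triangle inequality the whole sequence
  has the same limit.
\<close>

lemma complete_surface_\<psi>: "complete_surface \<kappa> \<tau> (top_of_set torus) \<psi>"
  unfolding complete_surface_def
proof (intro allI impI)
  let ?d = "induced_dist \<kappa> \<tau> (top_of_set torus) \<psi>"
  fix s :: "nat \<Rightarrow> complex \<times> complex" assume "range s \<subseteq> topspace (top_of_set torus) \<and>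
       (\<forall>e>0. \<exists>M. \<forall>m\<ge>M. \<forall>n\<ge>M. ?d (s m) (s n) < e)"
  then have s: "\<And>n. s n \<in> torus" and cauchy: "\<And>e. e > 0 \<Longrightarrow> \<exists>M. \<forall>m\<ge>M. \<forall>n\<ge>M. ?d (s m) (s n) < e"
    by auto
  have \<psi>S: "\<psi> ` torus \<subseteq> S3" using smooth_immersion_\<psi> by (simp add: smooth_immersion_def)
  note dist = induced_dist_le_length[OF \<kappa> \<psi>S] induced_dist_nonneg[OF \<kappa> \<psi>S] induced_dist_triangle[OF \<kappa> \<psi>S]
  define z where "z n = P_inv 0 (s n)" for n
  have Pz: "P (z n) = s n" for n using P_P_inv[OF s] by (simp add: z_def)
  have "bounded (range z)"
    by (rule bounded_subset[OF bounded_P_inv]) (use s in \<open>auto simp: z_def\<close>)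
  then obtain r w where r: "strict_mono r" "(z \<circ> r) \<longlonglongrightarrow> w"
    using bounded_imp_convergent_subsequence by blast
  have "(\<lambda>n. ?d (s n) (P w)) \<longlonglongrightarrow> 0"
  proof (rule LIMSEQ_I)
    fix e :: real assume e: "e > 0"
    obtain M where M: "\<And>m n. m \<ge> M \<Longrightarrow> n \<ge> M \<Longrightarrow> ?d (s m) (s n) < e / 2"
      using cauchy[of "e / 2"] e by auto
    have "(\<lambda>n. sqrt (4 / \<kappa>) * cmod (w - (z \<circ> r) n)) \<longlonglongrightarrow> sqrt (4 / \<kappa>) * cmod (w - w)"
      by (intro tendsto_intros r)
    then have "\<forall>\<^sub>F n in sequentially. sqrt (4 / \<kappa>) * cmod (w - (z \<circ> r) n) < e / 2"
      using e by (intro order_tendstoD(2)) auto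
    then obtain k\<^sub>0 where "\<And>k. k \<ge> k\<^sub>0 \<Longrightarrow> sqrt (4 / \<kappa>) * cmod (w - z (r k)) < e / 2"
      by (auto simp: eventually_sequentially)
    then obtain k where k: "r k \<ge> M" "sqrt (4 / \<kappa>) * cmod (w - z (r k)) < e / 2"
      using seq_suble[OF r(1), of "max k\<^sub>0 M"] by (metis max.cobounded1 max.cobounded2 order_trans)
    show "\<exists>no. \<forall>n\<ge>no. norm (?d (s n) (P w) - 0) < e"
    proof (intro exI allI impI)
      fix n assume n: "n \<ge> M"
      have "?d (s n) (P w) \<le> ?d (s n) (s (r k)) + ?d (s (r k)) (P w)"
        using dist(3)[OF connecting_segment(1)[of "z n" "z (r k)"] connecting_segment(1)[of "z (r k)" w]]
        by (simp only: Pz)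
      also have "\<dots> < e / 2 + e / 2"
        using M[OF n k(1)] dist(1)[OF connecting_segment(1)[of "z (r k)" w]] k(2)
        unfolding connecting_segment(2) Pz by linarith
      finally have "?d (s n) (P w) < e" by simp
      moreover have "?d (s n) (P w) \<ge> 0"
        using dist(2)[OF connecting_segment(1)[of "z n" w]] by (simp only: Pz)
      ultimately show "norm (?d (s n) (P w) - 0) < e" by simp
    qed
  qed
  then show "\<exists>q\<in>topspace (top_of_set torus). (\<lambda>n. ?d (s n) q) \<longlonglongrightarrow> 0"
    using P_in_torus by auto
qed

end


section \<open>A closed horizontal curve of non-constant curvature\<close>

lemma antiderivative_exists:
  fixes f :: "real \<Rightarrow> real"
  assumes "\<And>x. isCont f x"
  shows "\<exists>F. \<forall>x. (F has_real_derivative f x) (at x)"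
  using einterval_antiderivative[of "- \<infinity>" "\<infinity>" f] assms
  by (simp add: has_real_derivative_iff_has_vector_derivative)

text \<open>
  Let \<open>a\<close>, \<open>b\<close>, \<open>d\<close> be real functions of \<open>x\<close> and put \<open>\<zeta> = (cos a e\<^sup>i\<^sup>b, sin a e\<^sup>i\<^sup>d)\<close>.  If
  \<open>a' = cos \<chi>\<close>, \<open>b' = - tan a sin \<chi>\<close> and \<open>d' = cot a sin \<chi>\<close> for an angle \<open>\<chi>\<close>, then \<open>\<zeta>\<close> is horizontal of unit
  speed, with \<open>\<zeta>' = e\<^sup>i\<^sup>\<chi> (- sin a e\<^sup>i\<^sup>b, cos a e\<^sup>i\<^sup>d)\<close>.  The choice \<open>\<chi> = 2 x\<close>, \<open>a = \<pi> / 4 + sin (2 x) / 2\<close> makes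
  all the functions explicit up to integration, and stays away from the poles \<open>a = 0\<close> and \<open>a = \<pi> / 2\<close>.
  Writing \<open>w = sin (2 x)\<close>, the equation \<open>2 a = \<pi> / 2 + w\<close> gives
  \<open>(d - b)' = 2 w / cos w\<close> and \<open>(b + d)' = - 2 w tan w\<close>.

  The projection of \<open>\<zeta>\<close> closes up by symmetry: the derivative of the longitude \<open>d - b\<close> is odd and has period
  \<open>\<pi>\<close>, so its integral over a period vanishes.
\<close>

definition height :: "real \<Rightarrow> real" where "height x = sin (2 * x)"

definition angle :: "real \<Rightarrow> real" where "angle x = pi / 4 + height x / 2"

definition half_curvature :: "real \<Rightarrow> real" where
  "half_curvature x = 1 - height x * tan (height x)"

definition half_curvature_deriv :: "real \<Rightarrow> real" where
  "half_curvature_deriv x = - (2 * cos (2 * x) * tan (height x) + height x * (2 * cos (2 * x) / (cos (height x))\<^sup>2))"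

lemma height_bounds: "\<bar>height x\<bar> \<le> 1" by (simp add: height_def abs_sin_le_one)

lemma cos_height: "cos (height x) \<ge> cos 1"
proof -
  have "cos \<bar>height x\<bar> \<ge> cos 1"
    using height_bounds[of x] pi_gt3 by (intro cos_monotone_0_pi_le) auto
  then show ?thesis by simp
qed

lemma cos_1_pos: "cos (1::real) > 0"
  using pi_gt3 by (intro cos_gt_zero) auto

lemma cos_height_pos: "cos (height x) > 0"
  using cos_height[of x] cos_1_pos by linarith

lemma height_deriv: "(height has_real_derivative 2 * cos (2 * x)) (at x)"
  unfolding height_def[abs_def] by (auto intro!: derivative_eq_intros)

lemma angle_deriv: "(angle has_real_derivative cos (2 * x)) (at x)"
  unfolding angle_def[abs_def] by (auto intro!: derivative_eq_intros height_deriv)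

lemma angle_range: "cos (angle x) > 0" "sin (angle x) > 0"
proof -
  have "0 < angle x" "angle x < pi / 2"
    using height_bounds[of x] pi_gt3 by (auto simp: angle_def abs_le_iff)
  then show "cos (angle x) > 0" "sin (angle x) > 0"
    by (auto intro!: cos_gt_zero sin_gt_zero)
qed

lemma angle_double:
  "cos (height x) = 2 * sin (angle x) * cos (angle x)"
  "sin (height x) = 2 * (sin (angle x))\<^sup>2 - 1"
proof -
  have a: "2 * angle x = height x + pi / 2" by (simp add: angle_def)
  show "cos (height x) = 2 * sin (angle x) * cos (angle x)"
    using sin_double[of "angle x"] unfolding a by (simp add: sin_add)
  show "sin (height x) = 2 * (sin (angle x))\<^sup>2 - 1"
    using cos_double_sin[of "angle x"] unfolding a by (simp add: cos_add)
qed

lemma half_curvature_deriv: "(half_curvature has_real_derivative half_curvature_deriv x) (at x)"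
  unfolding half_curvature_def[abs_def] half_curvature_deriv_def
  by (rule DERIV_cong[OF DERIV_diff[OF DERIV_const DERIV_mult[OF height_deriv DERIV_chain2[OF DERIV_tan height_deriv]]]])
    (use cos_height_pos[of x] in \<open>simp_all add: divide_inverse\<close>)

lemma half_curvature_deriv_le: "\<bar>half_curvature_deriv x\<bar> \<le> 2 / cos 1 + 2 / (cos 1)\<^sup>2"
proof -
  have c2: "\<bar>2 * cos (2 * x)\<bar> \<le> 2" using abs_cos_le_one[of "2 * x"] by (simp add: abs_mult)
  have t: "\<bar>tan (height x)\<bar> \<le> 1 / cos 1"
    unfolding tan_def abs_divide using cos_height[of x] cos_1_pos by (intro frac_le) auto
  have i: "1 / (cos (height x))\<^sup>2 \<le> 1 / (cos 1)\<^sup>2"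
    using cos_height[of x] cos_1_pos by (intro frac_le power_mono) auto
  have "\<bar>half_curvature_deriv x\<bar> \<le> \<bar>2 * cos (2 * x)\<bar> * \<bar>tan (height x)\<bar>
      + \<bar>height x\<bar> * \<bar>2 * cos (2 * x)\<bar> * (1 / (cos (height x))\<^sup>2)"
    unfolding half_curvature_deriv_def abs_minus_cancel by (rule order_trans[OF abs_triangle_ineq]) (simp add: abs_mult)
  also have "\<dots> \<le> 2 * (1 / cos 1) + 1 * 2 * (1 / (cos 1)\<^sup>2)"
    using c2 t i height_bounds[of x] by (intro add_mono mult_mono) auto
  finally show ?thesis by simp
qed

lemma half_curvature_nonconstant: "half_curvature 0 \<noteq> half_curvature (pi / 4)"
proof -
  have "height (pi / 4) = 1" by (simp add: height_def)
  moreover have "tan (1::real) > 0" using pi_gt3 by (intro tan_gt_zero) auto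
  ultimately show ?thesis by (simp add: half_curvature_def height_def)
qed

lemma polar_has_vector_derivative:
  assumes "(f has_real_derivative f') (at x)" "(b has_real_derivative b') (at x)"
  shows "((\<lambda>x. of_real (f x) * cis (b x)) has_vector_derivative
    (of_real f' + \<i> * of_real (f x * b')) * cis (b x)) (at x)"
proof -
  have 1: "((\<lambda>x. cis (b x)) has_vector_derivative b' *\<^sub>R (\<i> * cis (b x))) (at x)"
    using has_derivative_cis[OF assms(2)[unfolded has_field_derivative_def]]
    by (simp add: has_vector_derivative_def mult.commute)
  have 2: "((\<lambda>x. complex_of_real (f x)) has_vector_derivative of_real f') (at x)"
    using has_vector_derivative_of_real assms(1) by (simp add: has_real_derivative_iff_has_vector_derivative)
  show ?thesis
    by (rule has_vector_derivative_eq_rhs[OF has_vector_derivative_mult[OF 2 1]])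
      (simp add: scaleR_conv_of_real algebra_simps)
qed

lemma polar_inner:
  "(of_real r * cis s) \<bullet> (of_real r' * cis t) = r * r' * cos (s - t)"
  "(of_real r * cis s) \<bullet> (\<i> * (of_real r' * cis t)) = r * r' * sin (s - t)"
  by (simp_all add: inner_complex_def cos_diff sin_diff algebra_simps)

lemma Ck_on_ident: "Ck_on n (\<lambda>x. x) UNIV"
proof (cases n)
  case (Suc k)
  show ?thesis unfolding Suc by (rule Ck_on_SucI[where f' = "\<lambda>x v. v"]) (auto intro: Ck_on_const)
qed simp

lemma Ck_on_height: "Ck_on n (\<lambda>x. complex_of_real (height x)) UNIV"
proof -
  have "Ck_on n (\<lambda>x. complex_of_real 2 * complex_of_real x) UNIV"
    by (intro Ck_on_mult Ck_on_const Ck_on_bounded_linear_compose[OF bounded_linear_of_real Ck_on_ident])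
  then have "Ck_on n (\<lambda>x. complex_of_real (2 * x)) UNIV" by simp
  then show ?thesis unfolding height_def by (rule Ck_on_of_real_cos_sin)
qed

text \<open>
  In the proof \<open>l\<close> is the longitude \<open>d - b\<close> of the projection and \<open>m\<close> the mean of the phases \<open>b\<close> and \<open>d\<close>; the increase
  of \<open>m\<close> over a period is the holonomy.
\<close>

lemma horizontal_curve_exists: "\<exists>\<zeta> \<zeta>' \<beta>. horizontal_curve \<zeta> \<zeta>' half_curvature half_curvature_deriv pi \<beta>
    (2 / cos 1 + 2 / (cos 1)\<^sup>2)"
proof -
  have cont: "isCont height x" for x using height_deriv by (rule DERIV_isCont)
  have "cos (height x) \<noteq> 0" for x using cos_height_pos[of x] by simp
  then have "\<exists>l. \<forall>x. (l has_real_derivative 2 * height x / cos (height x)) (at x)"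
    "\<exists>m. \<forall>x. (m has_real_derivative - (height x * tan (height x))) (at x)"
    by (auto intro!: antiderivative_exists continuous_intros cont)
  then obtain l m where l: "\<And>x. (l has_real_derivative 2 * height x / cos (height x)) (at x)"
    and m: "\<And>x. (m has_real_derivative - (height x * tan (height x))) (at x)"
    by blast
  define b d where "b x = m x - l x / 2" and "d x = m x + l x / 2" for x
  define s c where "s x = sin (angle x)" and "c x = cos (angle x)" for x
  note pos = angle_range[folded s_def c_def]
  note dbl = angle_double[folded s_def c_def]
  have sc: "(c x)\<^sup>2 = 1 - (s x)\<^sup>2" for x by (simp add: s_def c_def cos_squared_eq)
  have tan: "tan (height x) = (2 * (s x)\<^sup>2 - 1) / (2 * s x * c x)" for x by (simp add: tan_def dbl)
  have db: "(b has_real_derivative - (height x * (s x / c x))) (at x)" for x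
  proof -
    have "- (height x * tan (height x)) - 2 * height x / cos (height x) / 2 = - (height x * (s x / c x))"
      unfolding tan dbl using pos[of x] by (simp add: field_simps power2_eq_square)
    then show ?thesis unfolding b_def[abs_def]
      by (intro DERIV_cong[OF DERIV_diff[OF m DERIV_cdivide[OF l]]])
  qed
  have dd: "(d has_real_derivative height x * (c x / s x)) (at x)" for x
  proof -
    have "- (height x * tan (height x)) + 2 * height x / cos (height x) / 2 = height x * ((1 - (s x)\<^sup>2) / (s x * c x))"
      unfolding tan dbl using pos[of x] by (simp add: field_simps power2_eq_square)
    also have "\<dots> = height x * (c x / s x)"
      unfolding sc[symmetric] using pos[of x] by (simp add: power2_eq_square)
    finally show ?thesis unfolding d_def[abs_def]
      by (intro DERIV_cong[OF DERIV_add[OF m DERIV_cdivide[OF l]]])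
  qed
  have dc: "(c has_real_derivative - s x * cos (2 * x)) (at x)"
    and ds: "(s has_real_derivative c x * cos (2 * x)) (at x)" for x
    unfolding s_def[abs_def] c_def[abs_def] by (auto intro!: derivative_eq_intros angle_deriv)
  define \<zeta> where "\<zeta> x = (of_real (c x) * cis (b x), of_real (s x) * cis (d x))" for x
  define \<zeta>' where "\<zeta>' x = (of_real (- s x) * cis (2 * x + b x), of_real (c x) * cis (2 * x + d x))" for x
  define \<beta> where "\<beta> = (m pi - m 0) / pi"
  have w: "height x = sin (2 * x)" for x by (simp add: height_def)
  have "horizontal_curve \<zeta> \<zeta>' half_curvature half_curvature_deriv pi \<beta> (2 / cos 1 + 2 / (cos 1)\<^sup>2)"
  proof
    show "pi > 0" by simp
    show "(half_curvature has_real_derivative half_curvature_deriv x) (at x)"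
      "\<bar>half_curvature_deriv x\<bar> \<le> 2 / cos 1 + 2 / (cos 1)\<^sup>2" for x
      by (rule half_curvature_deriv half_curvature_deriv_le)+
    show "\<exists>x y. half_curvature x \<noteq> half_curvature y" using half_curvature_nonconstant by blast
    fix x
    show "\<zeta> x \<bullet> \<zeta> x = 1" "\<zeta>' x \<bullet> \<zeta>' x = 1" "\<zeta>' x \<bullet> \<zeta> x = 0" "\<zeta>' x \<bullet> times_i (\<zeta> x) = 0"
      unfolding \<zeta>_def \<zeta>'_def times_i_def inner_prod_def fst_conv snd_conv polar_inner
      using sc[of x] by (simp_all add: power2_eq_square)
    (* rewrites the phases of \<zeta> as those of its derivative, so that coefficients can be compared *)
    have e: "cis (2 * x + t) * (of_real (cos (2 * x)) - \<i> * of_real (height x)) = cis t" for t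
    proof -
      have "of_real (cos (2 * x)) - \<i> * of_real (height x) = cis (- (2 * x))" by (simp add: complex_eq_iff w)
      then show ?thesis by (simp add: cis_mult)
    qed
    have "(\<zeta> has_vector_derivative
      ((of_real (- s x * cos (2 * x)) + \<i> * of_real (c x * - (height x * (s x / c x)))) * cis (b x),
       (of_real (c x * cos (2 * x)) + \<i> * of_real (s x * (height x * (c x / s x)))) * cis (d x))) (at x)"
      unfolding \<zeta>_def[abs_def] by (intro has_vector_derivative_Pair polar_has_vector_derivative dc ds db dd)
    also have "((of_real (- s x * cos (2 * x)) + \<i> * of_real (c x * - (height x * (s x / c x)))) * cis (b x),
       (of_real (c x * cos (2 * x)) + \<i> * of_real (s x * (height x * (c x / s x)))) * cis (d x)) = \<zeta>' x"
    proof -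
      have "cis (2 * x) = of_real (cos (2 * x)) + \<i> * of_real (height x)" by (simp add: complex_eq_iff w)
      then show ?thesis using pos[of x] unfolding \<zeta>'_def cis_mult[symmetric] by (simp add: algebra_simps)
    qed
    finally show "(\<zeta> has_vector_derivative \<zeta>' x) (at x)" .
    have c2: "((\<lambda>x. 2 * x + f x) has_real_derivative 2 + f') (at x)" if "(f has_real_derivative f') (at x)" for f f'
      using that by (auto intro!: derivative_eq_intros)
    have "(\<zeta>' has_vector_derivative
      ((of_real (- (c x * cos (2 * x))) + \<i> * of_real (- s x * (2 + - (height x * (s x / c x))))) * cis (2 * x + b x),
       (of_real (- s x * cos (2 * x)) + \<i> * of_real (c x * (2 + height x * (c x / s x)))) * cis (2 * x + d x))) (at x)"
      unfolding \<zeta>'_def[abs_def]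
      by (intro has_vector_derivative_Pair polar_has_vector_derivative dc DERIV_minus[OF ds] c2 db dd)
    also have "((of_real (- (c x * cos (2 * x))) + \<i> * of_real (- s x * (2 + - (height x * (s x / c x))))) * cis (2 * x + b x),
       (of_real (- s x * cos (2 * x)) + \<i> * of_real (c x * (2 + height x * (c x / s x)))) * cis (2 * x + d x))
       = (2 * half_curvature x) *\<^sub>R times_i (\<zeta>' x) - \<zeta> x"
    proof -
      have 1: "- s x * (2 + - (height x * (s x / c x))) = 2 * half_curvature x * - s x + c x * height x"
      proof -
        have "- s x * (2 + - (height x * (s x / c x))) - (2 * half_curvature x * - s x + c x * height x)
          = height x * (1 - (s x)\<^sup>2 - (c x)\<^sup>2) / c x"
          unfolding half_curvature_def tan using pos[of x] by (simp add: field_simps power2_eq_square)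
        then show ?thesis by (simp add: sc)
      qed
      have 2: "c x * (2 + height x * (c x / s x)) = 2 * half_curvature x * c x + s x * height x"
      proof -
        have "c x * (2 + height x * (c x / s x)) - (2 * half_curvature x * c x + s x * height x)
          = height x * ((c x)\<^sup>2 + (s x)\<^sup>2 - 1) / s x"
          unfolding half_curvature_def tan using pos[of x] by (simp add: field_simps power2_eq_square)
        then show ?thesis by (simp add: sc)
      qed
      show ?thesis
        unfolding 1 2 \<zeta>_def \<zeta>'_def e[of "b x", symmetric] e[of "d x", symmetric]
        by (simp add: times_i_def scaleR_conv_of_real algebra_simps)
    qed
    finally show "(\<zeta>' has_vector_derivative (2 * half_curvature x) *\<^sub>R times_i (\<zeta>' x) - \<zeta> x) (at x)" .
    have per: "height (x + pi) = height x" for x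
      unfolding w using sin_periodic[of "2 * x"] by (simp add: algebra_simps)
    have shift: "((\<lambda>x. f (x + pi) - f x) has_real_derivative 0) (at x)"
      if "\<And>x. (f has_real_derivative g (height x)) (at x)" for f g x
      using DERIV_diff[OF DERIV_shift[THEN iffD1, OF that[of "x + pi"]] that[of x]] by (simp add: per)
    have mx: "m (x + pi) - m x = \<beta> * pi"
      using DERIV_isconst_all[of "\<lambda>x. m (x + pi) - m x" x 0] shift[of m "\<lambda>h. - (h * tan h)", OF m]
      by (simp add: \<beta>_def)
    have "((\<lambda>x. l x - l (- x)) has_real_derivative 0) (at x)" for x
    proof -
      have "((\<lambda>x. l (- x)) has_real_derivative 2 * height (- x) / cos (height (- x)) * (- 1)) (at x)"
        by (rule DERIV_chain2[OF l]) (auto intro!: derivative_eq_intros)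
      from DERIV_diff[OF l this] show ?thesis by (simp add: w)
    qed
    (* l is even, and the interval from -pi/2 to pi/2 is a full period *)
    then have "l (pi / 2) - l (- (pi / 2)) = 0"
      using DERIV_isconst_all[of "\<lambda>x. l x - l (- x)" "pi / 2" 0] by simp
    then have lx: "l (x + pi) = l x"
      using DERIV_isconst_all[of "\<lambda>x. l (x + pi) - l x" x "- (pi / 2)"] shift[of l "\<lambda>h. 2 * h / cos h", OF l]
      by simp
    have "b (x + pi) = \<beta> * pi + b x" "d (x + pi) = \<beta> * pi + d x"
      using mx lx by (simp_all add: b_def d_def)
    then show "\<zeta> (x + pi) = rot (\<beta> * pi) (\<zeta> x)"
      by (simp add: \<zeta>_def rot_def s_def c_def angle_def per flip: cis_mult)
  next
    fix n
    have h: "Ck_on n (\<lambda>x. complex_of_real (height x)) UNIV" for n by (rule Ck_on_height)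
    have "Ck_on n (\<lambda>x. complex_of_real (pi / 4) + complex_of_real (height x) * of_real (1 / 2)) UNIV" for n
      by (intro Ck_on_add Ck_on_mult Ck_on_const h)
    then have "Ck_on n (\<lambda>x. complex_of_real (angle x)) UNIV" for n
      by (simp add: angle_def)
    then have Cc: "Ck_on n (\<lambda>x. complex_of_real (c x)) UNIV" and Cs: "Ck_on n (\<lambda>x. complex_of_real (s x)) UNIV" for n
      unfolding c_def s_def by (intro Ck_on_of_real_cos_sin; simp)+
    have n0: "complex_of_real (c x) \<noteq> 0" "complex_of_real (s x) \<noteq> 0" for x using pos[of x] by auto
    have "Ck_on n (\<lambda>x. complex_of_real (- 1) * (of_real (height x) * (of_real (s x) * inverse (of_real (c x))))) UNIV" for n
      by (intro Ck_on_mult Ck_on_inverse Ck_on_const h Cc Cs n0)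
    then have "Ck_on n (\<lambda>x. complex_of_real (- (height x * (s x / c x)))) UNIV" for n
      by (simp add: divide_inverse)
    from Ck_on_Suc_imp[OF Ck_on_of_real_antiderivative[OF db this]]
    have Cb: "Ck_on n (\<lambda>x. complex_of_real (b x)) UNIV" .
    have "Ck_on n (\<lambda>x. complex_of_real (height x) * (of_real (c x) * inverse (of_real (s x)))) UNIV" for n
      by (intro Ck_on_mult Ck_on_inverse Ck_on_const h Cc Cs n0)
    then have "Ck_on n (\<lambda>x. complex_of_real (height x * (c x / s x))) UNIV" for n
      by (simp add: divide_inverse)
    from Ck_on_Suc_imp[OF Ck_on_of_real_antiderivative[OF dd this]]
    have Cd: "Ck_on n (\<lambda>x. complex_of_real (d x)) UNIV" .
    show "Ck_on n \<zeta> UNIV"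
      unfolding \<zeta>_def[abs_def] cis_conv_exp
      by (intro Ck_on_Pair Ck_on_mult Ck_on_exp Ck_on_const Cb Cc Cd Cs)
  qed
  then show ?thesis by blast
qed


section \<open>The counterexample\<close>

theorem proposition7:
  fixes \<kappa> \<tau> :: real
  assumes "\<kappa> > 0" and "\<tau> \<noteq> 0"
  shows "(\<exists>(T :: (complex \<times> complex) topology) \<A> \<psi> h\<^sub>0.
            oriented_surface T \<A> \<and> compact_space T \<and> torus_space T \<and>
            smooth_immersion T \<A> \<psi> \<and>
            \<not> constant_mean_curvature \<kappa> \<tau> \<A> \<psi> \<and>
            0 \<le> h\<^sub>0 \<and> AR_inequality \<kappa> \<tau> T \<A> \<psi> (\<lambda>_. h\<^sub>0)) \<and>
         \<not> (\<forall>(T :: (complex \<times> complex) topology) \<A> \<psi> h.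
            oriented_surface T \<A> \<and> smooth_immersion T \<A> \<psi> \<and> complete_surface \<kappa> \<tau> T \<psi> \<and>
            continuous_map T euclideanreal h \<and> (\<forall>q\<in>topspace T. 0 \<le> h q) \<and>
            AR_inequality \<kappa> \<tau> T \<A> \<psi> h \<longrightarrow>
            constant_mean_curvature \<kappa> \<tau> \<A> \<psi>)"
proof -
  obtain \<zeta> \<zeta>' \<beta> where "horizontal_curve \<zeta> \<zeta>' half_curvature half_curvature_deriv pi \<beta> (2 / cos 1 + 2 / (cos 1)\<^sup>2)"
    using horizontal_curve_exists by blast
  then interpret hopf_cylinder \<zeta> \<zeta>' half_curvature half_curvature_deriv pi \<beta> "2 / cos 1 + 2 / (cos 1)\<^sup>2" \<kappa> \<tau>
    using assms by (intro hopf_cylinder.intro hopf_cylinder_axioms.intro)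
  let ?T = "top_of_set torus" and ?h = "2 / cos 1 + 2 / (cos 1)\<^sup>2 :: real"
  have h: "0 \<le> ?h" using order_trans[OF abs_ge_zero q'_le] by simp
  note facts = oriented_surface_torus torus_space_torus smooth_immersion_\<psi>
    not_constant_mean_curvature_\<psi> AR_inequality_\<psi> complete_surface_\<psi>
  have "compact_space ?T" using compact_torus by (simp add: compact_space_subtopology)
  with facts h show ?thesis
    by (intro conjI) (blast, metis continuous_map_const iso_tuple_UNIV_I topspace_euclidean)
qed

end
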